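(* Let $\mathbb{K}=\mathbb{R}$ or $\mathbb{C}$ and let $I$ be a countably infinite set. For each $i\in I$, let $E_i$ be a nonzero finite-dimensional normed space over $\mathbb{K}$. Let $X=\prod_{i\in I}E_i$ be endowed with the product topology. Then for each compatible metric $d$ on $X$ the following hold: (i) no operator $T\in L(X)$ is metrically positively expansive on $(X,d)$; (ii) no operator $T\in GL(X)$ is metrically expansive on $(X,d)$.
   Context: $L(X)$ is the set of continuous linear operators $X\to X$, and $GL(X)$ is the set of linear homeomorphisms of $X$ onto itself. A compatible metric on $X$ is any metric on $X$ that induces the given (product) topology; it is not assumed to be translation invariant or complete. $\mathbb{N}_0=\{0,1,2,\ldots\}$. A continuous map $T:X\to X$ on a metric space $(X,d)$ is metrically positively expansive if there exists $\delta>0$ such that for any $x,y\in X$ with $x\neq y$ there exists $n\in\mathbb{N}_0$ with $d(T^nx,T^ny)\ge\delta$. An invertible such map $T$ is metrically expansive if there exists $\delta>0$ such that for any $x,y\in X$ with $x\ne y$ there exists $n\in\mathbb{Z}$ with $d(T^nx,T^ny)\ge\delta$. *)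

theory Defs
  imports "HOL-Analysis.Analysis" "HOL-Algebra.Module"
begin

text \<open>
  The spaces \<open>E\<^sub>i\<close> of a product may all be different, so vector spaces are modules with
  explicit carriers. The scalar field is a subset \<open>K\<close> of the complex numbers:
  \<open>K = \<real>\<close> gives real and \<open>K = UNIV\<close> gives complex spaces. Only the fields
  \<^const>\<open>carrier\<close>, \<^const>\<open>zero\<close>, \<^const>\<open>add\<close> and \<^const>\<open>smult\<close> of a module record are relevant;
  the two multiplicative ring fields are ignored by \<^locale>\<open>module\<close>.
\<close>

definition scalar_field :: "complex set \<Rightarrow> complex ring"
  where "scalar_field K = \<lparr>carrier = K, mult = (*), one = 1, zero = 0, add = (+)\<rparr>"

lemma scalar_field_simps [simp]:
  "carrier (scalar_field K) = K" "mult (scalar_field K) = (*)" "one (scalar_field K) = 1"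
  "zero (scalar_field K) = 0" "add (scalar_field K) = (+)"
  by (simp_all add: scalar_field_def)

lemma field_scalar_field:
  assumes "K = \<real> \<or> K = UNIV"
  shows "field (scalar_field K)"
proof (rule cring.cring_fieldI2)
  have uminus: "- x \<in> K" if "x \<in> K" for x
    using assms that by auto
  show "cring (scalar_field K)"
  proof (rule cringI)
    show "abelian_group (scalar_field K)"
    proof (rule abelian_groupI)
      fix x assume "x \<in> carrier (scalar_field K)"
      then show "\<exists>y\<in>carrier (scalar_field K). y \<oplus>\<^bsub>scalar_field K\<^esub> x = \<zero>\<^bsub>scalar_field K\<^esub>"
        using uminus by (intro bexI[of _ "- x"]) auto
    qed (use assms in \<open>auto simp: algebra_simps\<close>)
    show "Group.comm_monoid (scalar_field K)"
      by (rule comm_monoidI) (use assms in \<open>auto simp: algebra_simps\<close>)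
  qed (use assms in \<open>auto simp: algebra_simps\<close>)
  show "\<exists>b\<in>carrier (scalar_field K). a \<otimes>\<^bsub>scalar_field K\<^esub> b = \<one>\<^bsub>scalar_field K\<^esub>"
    if "a \<in> carrier (scalar_field K)" "a \<noteq> \<zero>\<^bsub>scalar_field K\<^esub>" for a
    using that assms by (intro bexI[of _ "inverse a"]) auto
qed simp

locale normed_space_over = module "scalar_field K" V
  for K :: "complex set" and V :: "(complex, 'e) module" (structure) +
  fixes nrm :: "'e \<Rightarrow> real"
  assumes nrm_nonneg: "x \<in> carrier V \<Longrightarrow> 0 \<le> nrm x"
    and nrm_eq_0_iff: "x \<in> carrier V \<Longrightarrow> nrm x = 0 \<longleftrightarrow> x = \<zero>"
    and nrm_smult: "a \<in> K \<Longrightarrow> x \<in> carrier V \<Longrightarrow> nrm (a \<odot> x) = cmod a * nrm x"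
    and nrm_triangle: "x \<in> carrier V \<Longrightarrow> y \<in> carrier V \<Longrightarrow> nrm (x \<oplus> y) \<le> nrm x + nrm y"

text \<open>\<^locale>\<open>Metric_space\<close> demands symmetry and nonnegativity also outside the carrier,
  whence the default value 0.\<close>

definition norm_dist :: "(complex, 'e) module \<Rightarrow> ('e \<Rightarrow> real) \<Rightarrow> 'e \<Rightarrow> 'e \<Rightarrow> real"
  where "norm_dist V nrm x y =
    (if x \<in> carrier V \<and> y \<in> carrier V then nrm (x \<ominus>\<^bsub>V\<^esub> y) else 0)"

definition norm_topology :: "(complex, 'e) module \<Rightarrow> ('e \<Rightarrow> real) \<Rightarrow> 'e topology"
  where "norm_topology V nrm = Metric_space.mtopology (carrier V) (norm_dist V nrm)"

lemma (in normed_space_over) Metric_space_norm_dist: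
  assumes K: "K = \<real> \<or> K = UNIV"
  shows "Metric_space (carrier V) (norm_dist V nrm)"
proof
  have minus_one: "nrm (\<ominus> x) = nrm x" if x: "x \<in> carrier V" for x
  proof -
    have m1: "- 1 \<in> K" "1 \<in> K" "0 \<in> K"
      using K by auto
    have "(0 :: complex) \<odot> x \<oplus> (0 :: complex) \<odot> x = (0 :: complex) \<odot> x"
      using smult_l_distr[of 0 0 x] m1 x by simp
    then have z: "(0 :: complex) \<odot> x = \<zero>"
      using m1 x smult_closed[of 0 x] by (simp add: M.add.l_cancel_one)
    have "(- 1 :: complex) \<odot> x \<oplus> x = \<zero>"
      using smult_l_distr[of "-1" 1 x] smult_one[of x] m1 x z by simp
    then have "\<ominus> x = (- 1 :: complex) \<odot> x"
      using m1 x smult_closed[of "-1" x] by (simp add: M.minus_equality)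
    then show ?thesis
      using nrm_smult[of "-1" x] m1 x by simp
  qed
  have swap: "nrm (x \<ominus> y) = nrm (y \<ominus> x)" if "x \<in> carrier V" "y \<in> carrier V" for x y
  proof -
    have "\<ominus> (x \<ominus> y) = y \<ominus> x"
      using that by (simp add: M.minus_eq M.minus_add M.a_comm)
    then show ?thesis
      using minus_one[of "x \<ominus> y"] that by simp
  qed
  show "0 \<le> norm_dist V nrm x y" for x y
    by (simp add: norm_dist_def nrm_nonneg)
  show "norm_dist V nrm x y = norm_dist V nrm y x" for x y
    by (simp add: norm_dist_def swap)
  show "norm_dist V nrm x y = 0 \<longleftrightarrow> x = y" if "x \<in> carrier V" "y \<in> carrier V" for x y
  proof -
    have "x = y" if "x \<oplus> \<ominus> y = \<zero>"
      using M.minus_equality[OF that] \<open>x \<in> carrier V\<close> \<open>y \<in> carrier V\<close> by simp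
    then show ?thesis
      using that by (auto simp: norm_dist_def nrm_eq_0_iff M.minus_eq M.r_neg)
  qed
  show "norm_dist V nrm x z \<le> norm_dist V nrm x y + norm_dist V nrm y z"
    if "x \<in> carrier V" "y \<in> carrier V" "z \<in> carrier V" for x y z
  proof -
    have "x \<ominus> z = (x \<ominus> y) \<oplus> (y \<ominus> z)"
      using that M.r_neg1[of y "\<ominus> z"] by (simp add: M.minus_eq M.a_assoc)
    then show ?thesis
      using that nrm_triangle[of "x \<ominus> y" "y \<ominus> z"] by (simp add: norm_dist_def)
  qed
qed

definition finite_dimensional :: "complex set \<Rightarrow> (complex, 'e) module \<Rightarrow> bool"
  where "finite_dimensional K V \<longleftrightarrow>
    (\<exists>B. finite B \<and> B \<subseteq> carrier V \<and>
      (\<forall>v\<in>carrier V. \<exists>c\<in>B \<rightarrow> K. v = (\<Oplus>\<^bsub>V\<^esub>b\<in>B. c b \<odot>\<^bsub>V\<^esub> b)))"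

definition product_module :: "'i set \<Rightarrow> ('i \<Rightarrow> (complex, 'e) module) \<Rightarrow> (complex, 'i \<Rightarrow> 'e) module"
  where "product_module I E =
    \<lparr>carrier = (\<Pi>\<^sub>E i\<in>I. carrier (E i)),
     mult = (\<lambda>x y. \<lambda>i\<in>I. x i \<otimes>\<^bsub>E i\<^esub> y i),
     one = (\<lambda>i\<in>I. \<one>\<^bsub>E i\<^esub>),
     zero = (\<lambda>i\<in>I. \<zero>\<^bsub>E i\<^esub>),
     add = (\<lambda>x y. \<lambda>i\<in>I. x i \<oplus>\<^bsub>E i\<^esub> y i),
     smult = (\<lambda>a x. \<lambda>i\<in>I. a \<odot>\<^bsub>E i\<^esub> x i)\<rparr>"

definition linear_operator :: "complex set \<Rightarrow> (complex, 'x) module \<Rightarrow> ('x \<Rightarrow> 'x) \<Rightarrow> bool"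
  where "linear_operator K X T \<longleftrightarrow>
    T \<in> carrier X \<rightarrow> carrier X \<and>
    (\<forall>x\<in>carrier X. \<forall>y\<in>carrier X. T (x \<oplus>\<^bsub>X\<^esub> y) = T x \<oplus>\<^bsub>X\<^esub> T y) \<and>
    (\<forall>a\<in>K. \<forall>x\<in>carrier X. T (a \<odot>\<^bsub>X\<^esub> x) = a \<odot>\<^bsub>X\<^esub> T x)"

lemma module_product_module:
  assumes K: "K = \<real> \<or> K = UNIV" and E: "\<And>i. i \<in> I \<Longrightarrow> module (scalar_field K) (E i)"
  shows "module (scalar_field K) (product_module I E)"
proof (rule moduleI)
  have ag: "abelian_group (E i)" if "i \<in> I" for i
    using E[OF that] by (rule module.axioms)
  have am: "abelian_monoid (E i)" if "i \<in> I" for i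
    using ag[OF that] by (rule abelian_group.axioms)
  note simps = product_module_def PiE_iff
  show "cring (scalar_field K)"
    using field_scalar_field[OF K] fieldE(1) by blast
  show "abelian_group (product_module I E)"
  proof (rule abelian_groupI)
    fix x assume x: "x \<in> carrier (product_module I E)"
    define y where "y = (\<lambda>i\<in>I. \<ominus>\<^bsub>E i\<^esub> x i)"
    have "y \<in> carrier (product_module I E)"
      using x by (auto simp: y_def simps intro!: abelian_group.a_inv_closed[OF ag])
    moreover have "y \<oplus>\<^bsub>product_module I E\<^esub> x = \<zero>\<^bsub>product_module I E\<^esub>"
      using x by (auto simp: y_def simps abelian_group.l_neg[OF ag] intro!: restrict_ext)
    ultimately show "\<exists>y\<in>carrier (product_module I E).
        y \<oplus>\<^bsub>product_module I E\<^esub> x = \<zero>\<^bsub>product_module I E\<^esub>"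
      by blast
  next
    fix x y z
    assume "x \<in> carrier (product_module I E)" "y \<in> carrier (product_module I E)"
      "z \<in> carrier (product_module I E)"
    then show "x \<oplus>\<^bsub>product_module I E\<^esub> y \<oplus>\<^bsub>product_module I E\<^esub> z
        = x \<oplus>\<^bsub>product_module I E\<^esub> (y \<oplus>\<^bsub>product_module I E\<^esub> z)"
      by (auto simp: simps intro!: restrict_ext abelian_monoid.a_assoc[OF am])
  next
    fix x y assume "x \<in> carrier (product_module I E)" "y \<in> carrier (product_module I E)"
    then show "x \<oplus>\<^bsub>product_module I E\<^esub> y = y \<oplus>\<^bsub>product_module I E\<^esub> x"
      by (auto simp: simps intro!: restrict_ext abelian_monoid.a_comm[OF am])
  next
    fix x assume "x \<in> carrier (product_module I E)"
    then show "\<zero>\<^bsub>product_module I E\<^esub> \<oplus>\<^bsub>product_module I E\<^esub> x = x"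
      by (auto simp: simps abelian_monoid.l_zero[OF am] intro!: extensionalityI[of _ I])
  qed (auto simp: simps intro!: abelian_monoid.a_closed[OF am] abelian_monoid.zero_closed[OF am])
next
  note simps = product_module_def PiE_iff
  show "a \<odot>\<^bsub>product_module I E\<^esub> x \<in> carrier (product_module I E)"
    if "a \<in> carrier (scalar_field K)" "x \<in> carrier (product_module I E)" for a x
    using that by (auto simp: simps intro!: module.smult_closed[OF E])
  show "(a \<oplus>\<^bsub>scalar_field K\<^esub> b) \<odot>\<^bsub>product_module I E\<^esub> x =
      a \<odot>\<^bsub>product_module I E\<^esub> x \<oplus>\<^bsub>product_module I E\<^esub> b \<odot>\<^bsub>product_module I E\<^esub> x"
    if "a \<in> carrier (scalar_field K)" "b \<in> carrier (scalar_field K)" "x \<in> carrier (product_module I E)" for a b x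
    using that module.smult_l_distr[OF E, of _ a b]
    by (auto simp: simps intro!: restrict_ext)
  show "a \<odot>\<^bsub>product_module I E\<^esub> (x \<oplus>\<^bsub>product_module I E\<^esub> y) =
      a \<odot>\<^bsub>product_module I E\<^esub> x \<oplus>\<^bsub>product_module I E\<^esub> a \<odot>\<^bsub>product_module I E\<^esub> y"
    if "a \<in> carrier (scalar_field K)" "x \<in> carrier (product_module I E)" "y \<in> carrier (product_module I E)" for a x y
    using that by (auto simp: simps intro!: restrict_ext module.smult_r_distr[OF E])
  show "(a \<otimes>\<^bsub>scalar_field K\<^esub> b) \<odot>\<^bsub>product_module I E\<^esub> x =
      a \<odot>\<^bsub>product_module I E\<^esub> (b \<odot>\<^bsub>product_module I E\<^esub> x)"
    if "a \<in> carrier (scalar_field K)" "b \<in> carrier (scalar_field K)" "x \<in> carrier (product_module I E)" for a b x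
    using that module.smult_assoc1[OF E, of _ a b]
    by (auto simp: simps intro!: restrict_ext)
  show "\<one>\<^bsub>scalar_field K\<^esub> \<odot>\<^bsub>product_module I E\<^esub> x = x" if "x \<in> carrier (product_module I E)" for x
    using that module.smult_one[OF E]
    by (auto simp: simps intro!: extensionalityI[of _ I])
qed

lemma topspace_product_norm_topology:
  assumes K: "K = \<real> \<or> K = UNIV"
    and E: "\<And>i. i \<in> I \<Longrightarrow> normed_space_over K (E i) (nrm i)"
  shows "topspace (product_topology (\<lambda>i. norm_topology (E i) (nrm i)) I)
    = carrier (product_module I E)"
proof -
  have "topspace (norm_topology (E i) (nrm i)) = carrier (E i)" if "i \<in> I" for i
    using normed_space_over.Metric_space_norm_dist[OF E[OF that] K]
    unfolding norm_topology_def by (rule Metric_space.topspace_mtopology)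
  then show ?thesis
    by (auto simp: product_module_def PiE_iff)
qed

text \<open>\<open>L(X)\<close> and \<open>GL(X)\<close> for a topological vector space \<open>X\<close> with topology \<open>\<tau>\<close>.
  The values of an operator outside the carrier of \<open>X\<close> are arbitrary and never used.\<close>

definition continuous_operators ::
    "complex set \<Rightarrow> (complex, 'x) module \<Rightarrow> 'x topology \<Rightarrow> ('x \<Rightarrow> 'x) set"
  where "continuous_operators K X \<tau> = {T. linear_operator K X T \<and> continuous_map \<tau> \<tau> T}"

definition invertible_operators ::
    "complex set \<Rightarrow> (complex, 'x) module \<Rightarrow> 'x topology \<Rightarrow> ('x \<Rightarrow> 'x) set"
  where "invertible_operators K X \<tau> = {T. linear_operator K X T \<and> homeomorphic_map \<tau> \<tau> T}"

definition compatible_metric :: "'x topology \<Rightarrow> ('x \<Rightarrow> 'x \<Rightarrow> real) \<Rightarrow> bool"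
  where "compatible_metric \<tau> d \<longleftrightarrow>
    Metric_space (topspace \<tau>) d \<and> Metric_space.mtopology (topspace \<tau>) d = \<tau>"

text \<open>In the two definitions below, \<open>T\<close> is understood to be a continuous self-map of \<open>M\<close>, in the
  second one also bijective. Members of \<^const>\<open>continuous_operators\<close> and
  \<^const>\<open>invertible_operators\<close> have these properties.\<close>

definition metrically_positively_expansive ::
    "'x set \<Rightarrow> ('x \<Rightarrow> 'x \<Rightarrow> real) \<Rightarrow> ('x \<Rightarrow> 'x) \<Rightarrow> bool"
  where "metrically_positively_expansive M d T \<longleftrightarrow>
    (\<exists>\<delta>>0. \<forall>x\<in>M. \<forall>y\<in>M. x \<noteq> y \<longrightarrow> (\<exists>n::nat. d ((T ^^ n) x) ((T ^^ n) y) \<ge> \<delta>))"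

definition int_iterate :: "'x set \<Rightarrow> ('x \<Rightarrow> 'x) \<Rightarrow> int \<Rightarrow> 'x \<Rightarrow> 'x"
  where "int_iterate M T n = (if n \<ge> 0 then T ^^ nat n else inv_into M T ^^ nat (- n))"

definition metrically_expansive ::
    "'x set \<Rightarrow> ('x \<Rightarrow> 'x \<Rightarrow> real) \<Rightarrow> ('x \<Rightarrow> 'x) \<Rightarrow> bool"
  where "metrically_expansive M d T \<longleftrightarrow>
    (\<exists>\<delta>>0. \<forall>x\<in>M. \<forall>y\<in>M. x \<noteq> y \<longrightarrow>
      (\<exists>n::int. d (int_iterate M T n x) (int_iterate M T n y) \<ge> \<delta>))"

end

theory Submission
  imports Defs
begin

text \<open>
  Choosing bases of the \<open>E\<^sub>i\<close> identifies \<open>X\<close> with the space of all scalar sequences, that is, with the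
  full algebraic dual of the polynomials (pair \<open>x\<close> with the monomial of degree \<open>j\<close> to get \<open>x\<^sub>j\<close>), and
  continuous operators \<open>S\<close> become transposes of linear maps \<open>R\<close> of polynomials. Given finitely many
  coordinates, let \<open>V\<close> be the span of the corresponding monomials. If \<open>S\<close> is injective, then \<open>R\<close> is
  surjective, and the \<open>R\<close>-invariant subspace generated by \<open>V\<close> is proper: otherwise
  \<open>V \<subseteq> R W\<close> for some \<open>W = V + R V + \<dots> + R\<^sup>n V\<close>, so \<open>W \<subseteq> R W\<close>, hence \<open>R W = W\<close> by dimension
  and \<open>W\<close> is everything, though finite-dimensional. A functional vanishing on that subspace is a nonzero
  \<open>x\<close> whose whole \<open>S\<close>-orbit vanishes in the given coordinates.

  For (i) take \<open>S = T\<close>; if \<open>T\<close> is not injective, the orbit of a vector of its kernel is finite. For (ii) take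
  \<open>S = T + T\<^sup>-\<^sup>1\<close>; if \<open>S x = 0\<close>, then \<open>T\<^sup>2 x = - x\<close> and the orbit of \<open>x\<close> is finite, and if \<open>S\<close> is
  injective, the recurrence \<open>T\<^sup>n\<^sup>+\<^sup>1 = T\<^sup>n S - T\<^sup>n\<^sup>-\<^sup>1\<close> carries the vanishing of coordinates over from the
  vectors \<open>S\<^sup>k x\<close> and \<open>T S\<^sup>k x\<close> to the \<open>T\<close>-orbit of \<open>x\<close>. In either case there is a nonzero vector whose orbit is bounded in the given coordinates, and small multiples of it stay
  as close to 0 as desired.
\<close>

section \<open>Operators on sequences\<close>

text \<open>Polynomials serve here as the free vector space on the monomials. Scalar values of
  \<open>g\<close> give the pairing of a sequence with a polynomial; polynomial values of
  \<open>g\<close> give the transpose of an operator.\<close>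

definition (in vector_space) poly_comb :: "(nat \<Rightarrow> 'b) \<Rightarrow> 'a poly \<Rightarrow> 'b"
  where "poly_comb g p = (\<Sum>j\<le>degree p. scale (coeff p j) (g j))"

lemma (in vector_space) poly_comb_eq:
  assumes "degree p \<le> n"
  shows "poly_comb g p = (\<Sum>j\<le>n. scale (coeff p j) (g j))"
  unfolding poly_comb_def
  by (rule sum.mono_neutral_left) (use assms in \<open>auto simp: coeff_eq_0\<close>)

lemma vector_space_poly: "vector_space (Polynomial.smult :: 'k::field \<Rightarrow> _)"
  by unfold_locales (auto simp: smult_add_right smult_add_left)

lemma (in vector_space) linear_poly_comb:
  "Vector_Spaces.linear Polynomial.smult scale (poly_comb g)"
proof -
  have "poly_comb g (p + q) = poly_comb g p + poly_comb g q" for p q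
  proof -
    define n where "n = max (degree p) (degree q)"
    have "degree p \<le> n" "degree q \<le> n" "degree (p + q) \<le> n"
      using degree_add_le_max[of p q] by (auto simp: n_def)
    then show ?thesis
      by (simp add: poly_comb_eq scale_left_distrib sum.distrib)
  qed
  moreover have "poly_comb g (Polynomial.smult c p) = scale c (poly_comb g p)" for c p
    by (simp add: poly_comb_eq[OF degree_smult_le] poly_comb_def scale_sum_right)
  ultimately show ?thesis
    using vector_space_poly vector_space_axioms by (simp add: Vector_Spaces.linear_iff)
qed

lemma (in vector_space) poly_comb_monom: "poly_comb g (monom 1 m) = g m"
proof -
  have "poly_comb g (monom 1 m) = (\<Sum>j\<le>m. scale (coeff (monom 1 m) j) (g j))"
    by (rule poly_comb_eq) (rule degree_monom_le)
  also have "\<dots> = (\<Sum>j\<le>m. if m = j then g j else 0)"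
    by (rule sum.cong) (auto simp: coeff_monom)
  finally show ?thesis by simp
qed

text \<open>A polynomial is the sum of its monomial terms. For scalar values this makes every linear
  functional on polynomials a sequence, so functionals found by abstract linear algebra become
  vectors of the sequence space.\<close>

lemma (in vector_space) linear_eq_poly_comb:
  assumes "Vector_Spaces.linear Polynomial.smult scale f"
  shows "f p = poly_comb (\<lambda>j. f (monom 1 j)) p"
proof -
  interpret f: Vector_Spaces.linear Polynomial.smult scale f by fact
  have "p = (\<Sum>j\<le>degree p. Polynomial.smult (coeff p j) (monom 1 j))"
    by (simp add: poly_as_sum_of_monoms smult_monom)
  then have "f p = f (\<Sum>j\<le>degree p. Polynomial.smult (coeff p j) (monom 1 j))"
    by simp
  also have "\<dots> = poly_comb (\<lambda>j. f (monom 1 j)) p"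
    by (simp add: f.sum f.scale poly_comb_def)
  finally show ?thesis .
qed

abbreviation pairing :: "(nat \<Rightarrow> 'k::field) \<Rightarrow> 'k poly \<Rightarrow> 'k"
  where "pairing \<equiv> vector_space_over_itself.poly_comb"

lemmas linear_pairing = vector_space_over_itself.linear_poly_comb
  and pairing_monom = vector_space_over_itself.poly_comb_monom

section \<open>Row-finite operators and their transposes\<close>

text \<open>The last clause replaces continuity in the product topology: \<open>T\<close> acts as an
  infinite matrix whose rows have finite support. In this form the argument runs over any
  field.\<close>

definition row_finite_op :: "((nat \<Rightarrow> 'k::field) \<Rightarrow> nat \<Rightarrow> 'k) \<Rightarrow> bool"
  where "row_finite_op T \<longleftrightarrow>
    (\<forall>x y. T (\<lambda>j. x j + y j) = (\<lambda>j. T x j + T y j)) \<and>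
    (\<forall>c x. T (\<lambda>j. c * x j) = (\<lambda>j. c * T x j)) \<and>
    (\<forall>m. \<exists>N. \<forall>x. (\<forall>j<N. x j = 0) \<longrightarrow> T x m = 0)"

text \<open>Split \<open>x\<close> after \<open>N\<close> terms: the tail does not contribute to
  coordinate \<open>m\<close>, and the initial part is a finite combination of unit sequences. The
  polynomial \<open>r\<close> is row \<open>m\<close> of the matrix.\<close>

lemma row_finite_op_coordinate:
  fixes T :: "(nat \<Rightarrow> 'k::field) \<Rightarrow> nat \<Rightarrow> 'k"
  assumes "row_finite_op T"
  obtains r :: "'k poly" where "\<And>x. T x m = pairing x r"
proof -
  have add: "T (\<lambda>j. x j + y j) m = T x m + T y m" for x y
    using assms unfolding row_finite_op_def by metis
  have scale: "T (\<lambda>j. c * x j) m = c * T x m" for c x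
    using assms unfolding row_finite_op_def by metis
  obtain N where N: "\<And>x. (\<And>j. j < N \<Longrightarrow> x j = 0) \<Longrightarrow> T x m = 0"
    using assms unfolding row_finite_op_def by metis
  define e where "e i = (\<lambda>j. if j = i then 1 else 0 :: 'k)" for i :: nat
  define r where "r = (\<Sum>j<N. monom (T (e j) m) j)"
  have trunc: "T (\<lambda>j. if j < n then x j else 0) m = (\<Sum>j<n. T (e j) m * x j)" for n x
  proof (induction n)
    case 0
    show ?case using N[of "\<lambda>_. 0"] by simp
  next
    case (Suc n)
    have "(\<lambda>j. if j < Suc n then x j else 0)
        = (\<lambda>j. (if j < n then x j else 0) + x n * e n j)"
      by (auto simp: e_def fun_eq_iff less_Suc_eq)
    then show ?case
      by (simp add: add scale Suc.IH mult.commute)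
  qed
  have "T x m = pairing x r" for x
  proof -
    have "T x m = T (\<lambda>j. (if j < N then x j else 0) + (if j < N then 0 else x j)) m"
      by (rule arg_cong[of _ _ "\<lambda>y. T y m"]) auto
    also have "\<dots> = (\<Sum>j<N. T (e j) m * x j)"
      using add[of "\<lambda>j. if j < N then x j else 0" "\<lambda>j. if j < N then 0 else x j"]
        N[of "\<lambda>j. if j < N then 0 else x j"] trunc[of N x] by simp
    also have "\<dots> = (\<Sum>j\<le>N. coeff r j * x j)"
    proof (rule sum.mono_neutral_cong_left)
      show "T (e j) m * x j = coeff r j * x j" if "j \<in> {..<N}" for j
        using that by (simp add: r_def coeff_sum coeff_monom)
      show "\<forall>j\<in>{..N} - {..<N}. coeff r j * x j = 0"
        by (auto simp: r_def coeff_sum coeff_monom)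
    qed auto
    also have "\<dots> = pairing x r"
    proof (rule vector_space_over_itself.poly_comb_eq[symmetric])
      show "degree r \<le> N"
        unfolding r_def by (rule degree_le) (auto simp: coeff_sum coeff_monom)
    qed
    finally show ?thesis .
  qed
  then show ?thesis by (rule that)
qed

text \<open>The rows are polynomials, so sending the monomial of degree \<open>m\<close> to row
  \<open>m\<close> defines a transpose that stays within the polynomials.\<close>

lemma row_finite_op_transpose:
  fixes T :: "(nat \<Rightarrow> 'k::field) \<Rightarrow> nat \<Rightarrow> 'k"
  assumes "row_finite_op T"
  obtains R :: "'k poly \<Rightarrow> 'k poly" where
    "Vector_Spaces.linear Polynomial.smult Polynomial.smult R"
    "\<And>x p. pairing (T x) p = pairing x (R p)"
proof -
  interpret P: vector_space "Polynomial.smult :: 'k \<Rightarrow> _" by (rule vector_space_poly)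
  obtain r where r: "\<And>x m. T x m = pairing x (r m)"
    using row_finite_op_coordinate[OF assms] by meson
  show ?thesis
  proof (rule that)
    show "Vector_Spaces.linear Polynomial.smult Polynomial.smult (P.poly_comb r)"
      by (rule P.linear_poly_comb)
    show "pairing (T x) p = pairing x (P.poly_comb r p)" for x p
    proof -
      interpret f: Vector_Spaces.linear Polynomial.smult "(*)" "pairing x"
        by (rule linear_pairing)
      show ?thesis
        by (simp add: P.poly_comb_def f.sum f.scale flip: r) (simp add: vector_space_over_itself.poly_comb_def)
    qed
  qed
qed

section \<open>Subspaces of polynomials: annihilators and dimension\<close>

text \<open>A basis of the span stays independent when a vector \<open>v\<close> outside the span is
  added, so some functional is 1 at \<open>v\<close> and 0 on the basis. Its values on the monomials
  form the sequence \<open>x\<close>.\<close>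

lemma nonzero_functional_vanishing_on_span:
  fixes A :: "'k::field poly set"
  assumes "module.span Polynomial.smult A \<noteq> UNIV"
  obtains x where "x \<noteq> (\<lambda>_. 0)" "\<And>p. p \<in> A \<Longrightarrow> pairing x p = 0"
proof -
  interpret P: vector_space "Polynomial.smult :: 'k \<Rightarrow> _" by (rule vector_space_poly)
  interpret PK: vector_space_pair "Polynomial.smult :: 'k \<Rightarrow> _" "(*) :: 'k \<Rightarrow> _" ..
  obtain v where v: "v \<notin> P.span A"
    using assms by blast
  obtain B where B: "B \<subseteq> A" "P.independent B" "A \<subseteq> P.span B"
    using P.maximal_independent_subset[of A] by blast
  have "P.span A = P.span B"
    using B by (metis P.span_mono P.span_span subset_antisym)
  with v B have "P.independent (insert v B)" "v \<notin> B"
    using P.span_base by (auto simp: P.independent_insert)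
  from PK.linear_independent_extend[OF this(1), of "\<lambda>p. if p = v then 1 else 0"]
  obtain f where f: "Vector_Spaces.linear Polynomial.smult (*) f"
      and fB: "\<forall>p\<in>insert v B. f p = (if p = v then 1 else 0)"
    by blast
  interpret f: Vector_Spaces.linear Polynomial.smult "(*)" f by fact
  define x where "x = (\<lambda>j. f (monom 1 j))"
  have x: "pairing x p = f p" for p
    unfolding x_def using vector_space_over_itself.linear_eq_poly_comb[OF f] by metis
  show ?thesis
  proof (rule that)
    have "f v = 1" using fB by simp
    with x[of v] show "x \<noteq> (\<lambda>_. 0)"
      by (auto simp: vector_space_over_itself.poly_comb_def)
    show "pairing x p = 0" if "p \<in> A" for p
      unfolding x
    proof (rule f.eq_0_on_span)
      show "p \<in> P.span B" using that B by blast
      show "f b = 0" if "b \<in> B" for b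
        using fB that \<open>v \<notin> B\<close> by auto
    qed
  qed
qed

text \<open>Degrees are bounded on the span of a finite set. This is how the infinite dimension of
  the space enters.\<close>

lemma poly_span_finite_neq_UNIV:
  fixes B :: "'k::field poly set"
  assumes "finite B"
  shows "module.span Polynomial.smult B \<noteq> UNIV"
proof
  interpret P: vector_space "Polynomial.smult :: 'k \<Rightarrow> _" by (rule vector_space_poly)
  assume U: "P.span B = UNIV"
  obtain n where n: "\<forall>p\<in>B. degree p \<le> n"
    using finite_nat_set_iff_bounded_le[of "degree ` B"] assms by auto
  have "P.span B \<subseteq> {p. degree p \<le> n}"
    by (rule P.span_minimal)
      (use n in \<open>auto simp: P.subspace_def intro: degree_add_le order_trans[OF degree_smult_le]\<close>)
  with U have "degree (monom (1::'k) (Suc n)) \<le> n" by blast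
  then show False by (simp add: degree_monom_eq)
qed

text \<open>Comparison of dimensions: the images of a basis \<open>B\<close> span at least
  \<open>span B\<close>, and a vector of their span outside \<open>span B\<close> would give
  \<open>card B + 1\<close> independent vectors in a space spanned by at most
  \<open>card B\<close>.\<close>

lemma (in vector_space) span_image_eq_if_subset:
  assumes "Vector_Spaces.linear scale scale R" "finite G" "span G \<subseteq> R ` span G"
  shows "R ` span G = span G"
proof -
  interpret R: Vector_Spaces.linear scale scale R by fact
  obtain B where B: "B \<subseteq> G" "independent B" "G \<subseteq> span B"
    using maximal_independent_subset[of G] by blast
  have GB: "span G = span B"
    using B by (metis span_mono span_span subset_antisym)
  have fin: "finite B" using B assms(2) finite_subset by blast
  have "B \<subseteq> span (R ` B)"
    using assms(3) GB span_superset[of B] by (simp add: R.span_image)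
  then have sub: "span B \<subseteq> span (R ` B)"
    by (simp add: span_minimal subspace_span)
  have "p \<in> span B" if p: "p \<in> span (R ` B)" for p
  proof (rule ccontr)
    assume "p \<notin> span B"
    then have "independent (insert p B)" "p \<notin> B"
      using B span_base by (auto simp: independent_insert)
    then have "card (insert p B) \<le> card (R ` B)"
      using independent_span_bound[of "R ` B" "insert p B"] fin p \<open>B \<subseteq> span (R ` B)\<close> by simp
    then show False
      using card_image_le[OF fin, of R] \<open>p \<notin> B\<close> fin by simp
  qed
  with sub show ?thesis
    by (auto simp: GB R.span_image)
qed

section \<open>Orbits that are finite up to given coordinates\<close>

text \<open>By transposition, coordinate \<open>j\<close> of \<open>(S ^^ n) x\<close> is the
  pairing of \<open>x\<close> with \<open>(R ^^ n) (monom 1 j)\<close>. It therefore suffices that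
  the span of all these polynomials with \<open>j < N\<close> is proper.\<close>

lemma exists_orbit_vanishing_on_initial_segment:
  fixes S :: "(nat \<Rightarrow> 'k::field) \<Rightarrow> nat \<Rightarrow> 'k"
  assumes S: "row_finite_op S" and inj: "\<And>x. S x = (\<lambda>_. 0) \<Longrightarrow> x = (\<lambda>_. 0)"
  obtains x where "x \<noteq> (\<lambda>_. 0)" "\<And>n j. j < N \<Longrightarrow> (S ^^ n) x j = 0"
proof -
  interpret P: vector_space "Polynomial.smult :: 'k \<Rightarrow> _" by (rule vector_space_poly)
  obtain R :: "'k poly \<Rightarrow> 'k poly" where lin: "Vector_Spaces.linear Polynomial.smult Polynomial.smult R"
    and R: "\<And>x p. pairing (S x) p = pairing x (R p)"
    using row_finite_op_transpose[OF S] by blast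
  interpret R: Vector_Spaces.linear Polynomial.smult Polynomial.smult R by fact
  have Rn: "pairing ((S ^^ n) x) p = pairing x ((R ^^ n) p)" for n x p
    by (induction n arbitrary: x p) (simp_all add: R flip: funpow_swap1)
  \<comment> \<open>A nonzero sequence that annihilates a proper range of \<open>R\<close> would lie
    in the kernel of \<open>S\<close>.\<close>
  have surj: "surj R"
  proof (rule ccontr)
    assume "\<not> surj R"
    moreover have "P.span (range R) = range R"
      by (simp add: R.span_image)
    ultimately obtain x where x: "x \<noteq> (\<lambda>_. 0)" "\<And>p. p \<in> range R \<Longrightarrow> pairing x p = 0"
      using nonzero_functional_vanishing_on_span by metis
    have "S x m = 0" for m
      using R[of x "monom 1 m"] x(2)[of "R (monom 1 m)"] by (simp add: pairing_monom)
    with inj x(1) show False by blast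
  qed
  define G where "G n = (\<lambda>(k, j). (R ^^ k) (monom 1 j)) ` ({..<n} \<times> {..<N})" for n
  define A where "A = (\<Union>n. G n)"
  have G_mono: "G m \<subseteq> G n" if "m \<le> n" for m n
    using that by (auto simp: G_def)
  have "P.span A \<noteq> UNIV"
  proof
    assume U: "P.span A = UNIV"
    \<comment> \<open>The sets \<open>G n\<close> increase, so the finitely many generators used for
      \<open>p\<close> lie in one of them.\<close>
    have ex: "\<exists>n. p \<in> P.span (G n)" for p
    proof -
      have "p \<in> P.span A" by (simp add: U)
      then obtain t r where t: "finite t" "t \<subseteq> A" and p: "p = (\<Sum>a\<in>t. Polynomial.smult (r a) a)"
        by (auto simp: P.span_explicit)
      have "\<exists>n. t \<subseteq> G n"
        using t
      proof induction
        case (insert a t)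
        then obtain m n where "t \<subseteq> G n" "a \<in> G m" by (auto simp: A_def)
        then have "insert a t \<subseteq> G (max m n)"
          using G_mono[of n "max m n"] G_mono[of m "max m n"] by auto
        then show ?case by blast
      qed simp
      then obtain n where "t \<subseteq> G n" by blast
      then have "p \<in> P.span (G n)"
        unfolding p by (auto intro: P.span_sum P.span_scale P.span_base)
      then show ?thesis by blast
    qed
    have "\<forall>j. \<exists>p. R p = monom 1 j" using surj by (metis surjD)
    then obtain q where q: "\<And>j. R (q j) = monom 1 j" by metis
    have "\<forall>j. \<exists>n. q j \<in> P.span (G n)" using ex by blast
    then obtain h where h: "\<And>j. q j \<in> P.span (G (h j))" by metis
    define n where "n = (\<Sum>j<N. h j)"
    have qn: "q j \<in> P.span (G n)" if "j < N" for j
    proof -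
      have "h j \<le> n" unfolding n_def using that by (intro member_le_sum) auto
      then show ?thesis using h[of j] P.span_mono[OF G_mono] by blast
    qed
    have fin: "finite (G n)" by (simp add: G_def)
    \<comment> \<open>For \<open>k = 0\<close> the preimage is \<open>q j\<close>, which is in the
      span by the choice of \<open>n\<close>; for positive \<open>k\<close> it is the preceding
      iterate, a member of \<open>G n\<close>.\<close>
    have "(R ^^ k) (monom 1 j) \<in> R ` P.span (G n)" if "k < Suc n" "j < N" for k j
    proof (cases k)
      case 0
      then show ?thesis using q[of j] qn[OF that(2)] by (auto intro: rev_image_eqI)
    next
      case (Suc l)
      then have "(R ^^ l) (monom 1 j) \<in> G n" using that by (auto simp: G_def)
      then show ?thesis using Suc P.span_base by auto
    qed
    then have Gsub: "G (Suc n) \<subseteq> R ` P.span (G n)"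
      by (auto simp: G_def)
    then have "G n \<subseteq> R ` P.span (G n)" using G_mono[of n "Suc n"] by auto
    then have "P.span (G n) \<subseteq> R ` P.span (G n)"
      by (rule P.span_minimal) (simp add: R.subspace_image)
    then have inv: "R ` P.span (G n) = P.span (G n)"
      by (rule P.span_image_eq_if_subset[OF lin fin])
    \<comment> \<open>Invariance keeps all iterates in the span of \<open>G n\<close>, so this
      finite set would span all polynomials.\<close>
    have "(R ^^ k) (monom 1 j) \<in> P.span (G n)" if "j < N" for k j
    proof (induction k)
      case 0
      have "monom 1 j \<in> R ` P.span (G n)" using q[of j] qn[OF that] by (metis imageI)
      then show ?case using inv by simp
    next
      case (Suc k)
      then show ?case using inv by auto
    qed
    then have "A \<subseteq> P.span (G n)" by (auto simp: A_def G_def)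
    then have "P.span A \<subseteq> P.span (G n)" by (rule P.span_minimal) simp
    then show False using U poly_span_finite_neq_UNIV[OF fin] by blast
  qed
  then obtain x where x: "x \<noteq> (\<lambda>_. 0)" "\<And>p. p \<in> A \<Longrightarrow> pairing x p = 0"
    using nonzero_functional_vanishing_on_span by blast
  show ?thesis
  proof (rule that[OF x(1)])
    fix n j assume "j < N"
    then have "(R ^^ n) (monom 1 j) \<in> A" by (auto simp: A_def G_def intro: lessI)
    then show "(S ^^ n) x j = 0"
      using x(2) Rn[of n x "monom 1 j"] by (simp add: pairing_monom)
  qed
qed

lemma exists_bounded_orbit:
  fixes T :: "(nat \<Rightarrow> 'k::field) \<Rightarrow> nat \<Rightarrow> 'k"
  assumes T: "row_finite_op T"
  obtains x where "x \<noteq> (\<lambda>_. 0)" "finite {y \<in> range (\<lambda>n. (T ^^ n) x). \<exists>j<N. y j \<noteq> 0}"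
proof (cases "\<exists>x. x \<noteq> (\<lambda>_. 0) \<and> T x = (\<lambda>_. 0)")
  case True
  then obtain x where x: "x \<noteq> (\<lambda>_. 0)" "T x = (\<lambda>_. 0)" by blast
  have "T (\<lambda>j. 0 * x j) = (\<lambda>j. 0 * T x j)"
    using T unfolding row_finite_op_def by blast
  then have T0: "T (\<lambda>_. 0) = (\<lambda>_. 0)" by simp
  have "(T ^^ n) x \<in> {x, \<lambda>_. 0}" for n
    by (induction n) (use x T0 in auto)
  then have "{y \<in> range (\<lambda>n. (T ^^ n) x). \<exists>j<N. y j \<noteq> 0} \<subseteq> {x, \<lambda>_. 0}"
    by blast
  then show ?thesis
    using that[OF x(1)] finite_subset by blast
next
  case False
  then obtain x where x: "x \<noteq> (\<lambda>_. 0)" "\<And>n j. j < N \<Longrightarrow> (T ^^ n) x j = 0"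
    using exists_orbit_vanishing_on_initial_segment[OF T, of N] by blast
  then have "{y \<in> range (\<lambda>n. (T ^^ n) x). \<exists>j<N. y j \<noteq> 0} = {}"
    by blast
  then show ?thesis
    using that[OF x(1)] by (metis finite.emptyI)
qed

text \<open>With \<open>S = T + U\<close>, both \<open>V = T\<close> and \<open>V = U\<close>
  satisfy \<open>V (V y) = V (S y) - y\<close>. An \<open>S\<close>-orbit that vanishes in enough
  coordinates therefore controls both half-orbits; a kernel vector of \<open>S\<close> is treated
  directly.\<close>

lemma exists_bounded_two_sided_orbit:
  fixes T U :: "(nat \<Rightarrow> 'k::field) \<Rightarrow> nat \<Rightarrow> 'k"
  assumes T: "row_finite_op T" and U: "row_finite_op U"
    and UT: "\<And>x. U (T x) = x" and TU: "\<And>x. T (U x) = x"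
  obtains x where "x \<noteq> (\<lambda>_. 0)"
    "finite {y \<in> range (\<lambda>n. (T ^^ n) x) \<union> range (\<lambda>n. (U ^^ n) x). \<exists>j<N. y j \<noteq> 0}"
proof -
  define S where "S x = (\<lambda>j. T x j + U x j)" for x
  have Tadd: "T (\<lambda>j. x j + y j) = (\<lambda>j. T x j + T y j)"
    and Uadd: "U (\<lambda>j. x j + y j) = (\<lambda>j. U x j + U y j)"
    and Tscale: "T (\<lambda>j. c * x j) = (\<lambda>j. c * T x j)"
    and Uscale: "U (\<lambda>j. c * x j) = (\<lambda>j. c * U x j)" for x y c
    using T U unfolding row_finite_op_def by blast+
  have S: "row_finite_op S"
    unfolding row_finite_op_def
  proof (intro conjI allI)
    show "S (\<lambda>j. x j + y j) = (\<lambda>j. S x j + S y j)" for x y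
      by (auto simp: S_def Tadd Uadd algebra_simps)
    show "S (\<lambda>j. c * x j) = (\<lambda>j. c * S x j)" for c x
      by (auto simp: S_def Tscale Uscale algebra_simps)
    fix m
    obtain M M' where M: "\<And>x. \<forall>j<M. x j = 0 \<Longrightarrow> T x m = 0"
      using T unfolding row_finite_op_def by metis
    obtain M' where M': "\<And>x. \<forall>j<M'. x j = 0 \<Longrightarrow> U x m = 0"
      using U unfolding row_finite_op_def by metis
    have "S x m = 0" if "\<forall>j<max M M'. x j = 0" for x
      using M[of x] M'[of x] that by (simp add: S_def)
    then show "\<exists>N. \<forall>x. (\<forall>j<N. x j = 0) \<longrightarrow> S x m = 0"
      by blast
  qed
  show ?thesis
  proof (cases "\<exists>x. x \<noteq> (\<lambda>_. 0) \<and> S x = (\<lambda>_. 0)")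
    case True
    then obtain x where x: "x \<noteq> (\<lambda>_. 0)" "S x = (\<lambda>_. 0)" by blast
    then have "U x = (\<lambda>j. - 1 * T x j)"
      by (auto simp: S_def fun_eq_iff add_eq_0_iff)
    then have "T (U x) = (\<lambda>j. - 1 * T (T x) j)" by (simp only: Tscale)
    then have TT: "T (T x) = (\<lambda>j. - x j)" by (simp add: TU fun_eq_iff)
    have Tminus: "T (\<lambda>j. - y j) = (\<lambda>j. - T y j)" and Uminus: "U (\<lambda>j. - y j) = (\<lambda>j. - U y j)" for y
      using Tscale[of "-1" y] Uscale[of "-1" y] by simp_all
    \<comment> \<open>As \<open>T (T x) = - x\<close>, four applications of \<open>T\<close> return
      to \<open>x\<close>, and these vectors contain the whole two-sided orbit.\<close>
    define P where "P = {x, T x, \<lambda>j. - x j, \<lambda>j. - T x j}"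
    have Ux: "U x = (\<lambda>j. - T x j)" using \<open>U x = (\<lambda>j. - 1 * T x j)\<close> by simp
    have P_inv: "T y \<in> P \<and> U y \<in> P" if "y \<in> P" for y
      using that by (auto simp: P_def TT UT Ux Tminus Uminus)
    have "(T ^^ n) x \<in> P \<and> (U ^^ n) x \<in> P" for n
      by (induction n) (use P_inv in \<open>auto simp: P_def\<close>)
    then have "{y \<in> range (\<lambda>n. (T ^^ n) x) \<union> range (\<lambda>n. (U ^^ n) x). \<exists>j<N. y j \<noteq> 0} \<subseteq> P"
      by blast
    moreover have "finite P" by (simp add: P_def)
    ultimately show ?thesis
      using that[OF x(1)] finite_subset by blast
  next
    case False
    have "\<forall>j. \<exists>M. \<forall>x. (\<forall>i<M. x i = 0) \<longrightarrow> T x j = 0"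
      using T unfolding row_finite_op_def by blast
    then obtain M where M: "\<And>j x. \<forall>i<M j. x i = 0 \<Longrightarrow> T x j = 0"
      by metis
    \<comment> \<open>Coordinate \<open>j\<close> of \<open>T y\<close> depends on the coordinates
      of \<open>y\<close> below \<open>M j\<close>. The \<open>S\<close>-orbit of \<open>x\<close>
      is made to vanish up to a bound that covers these for all \<open>j < N\<close>, as well as
      \<open>N\<close> itself.\<close>
    define N' where "N' = N + (\<Sum>j<N. M j)"
    have M_le: "M j \<le> N'" if "j < N" for j
    proof -
      have "M j \<le> (\<Sum>j<N. M j)" using that by (intro member_le_sum) auto
      then show ?thesis by (simp add: N'_def)
    qed
    obtain x where x: "x \<noteq> (\<lambda>_. 0)" and x0: "\<And>n j. j < N' \<Longrightarrow> (S ^^ n) x j = 0"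
      using exists_orbit_vanishing_on_initial_segment[OF S, of N'] False by blast
    have S_pow: "(S ^^ k) x j = 0" if "j < N" for j k
      using x0[of j k] that by (simp add: N'_def)
    have TS_pow: "T ((S ^^ k) x) j = 0" if "j < N" for j k
      using M[of j "(S ^^ k) x"] x0[of _ k] M_le[OF that] by auto
    \<comment> \<open>Here \<open>U y = S y - T y\<close>, and \<open>S y\<close> is the next vector
      of the \<open>S\<close>-orbit.\<close>
    have US_pow: "U ((S ^^ k) x) j = 0" if "j < N" for j k
      using S_pow[OF that, of "Suc k"] TS_pow[OF that, of k] by (simp add: S_def)
    have vanish: "(V ^^ n) x j = 0"
      if comm: "\<And>y. V (S y) = S (V y)" and V2: "\<And>y. V (V y) = (\<lambda>j. V (S y) j - y j)"
        and V1: "\<And>k j. j < N \<Longrightarrow> V ((S ^^ k) x) j = 0" and j: "j < N" for V n j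
    proof -
      have comm_pow: "(V ^^ n) (S y) = S ((V ^^ n) y)" for n y
        by (induction n) (simp_all add: comm)
      \<comment> \<open>The recurrence has two steps and passes from \<open>k\<close> to
        \<open>k + 1\<close>, so two consecutive powers of \<open>V\<close> and all \<open>k\<close>
        are treated together.\<close>
      have "(V ^^ n) ((S ^^ k) x) j = 0 \<and> (V ^^ Suc n) ((S ^^ k) x) j = 0" for n k
      proof (induction n arbitrary: k)
        case 0
        then show ?case using S_pow[OF j] V1[OF j] by simp
      next
        case (Suc n)
        have "(V ^^ Suc (Suc n)) ((S ^^ k) x) j
            = (V ^^ Suc n) ((S ^^ Suc k) x) j - (V ^^ n) ((S ^^ k) x) j"
          by (simp add: V2 comm_pow)
        then show ?case using Suc.IH[of k] Suc.IH[of "Suc k"] by simp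
      qed
      from this[of n 0] show ?thesis by simp
    qed
    have "(T ^^ n) x j = 0" if "j < N" for n j
    proof (rule vanish[where V = T, OF _ _ TS_pow that])
      show "T (S y) = S (T y)" "T (T y) = (\<lambda>j. T (S y) j - y j)" for y
        by (simp_all add: S_def Tadd TU UT)
    qed
    moreover have "(U ^^ n) x j = 0" if "j < N" for n j
    proof (rule vanish[where V = U, OF _ _ US_pow that])
      show "U (S y) = S (U y)" "U (U y) = (\<lambda>j. U (S y) j - y j)" for y
        by (simp_all add: S_def Uadd TU UT)
    qed
    ultimately have "{y \<in> range (\<lambda>n. (T ^^ n) x) \<union> range (\<lambda>n. (U ^^ n) x). \<exists>j<N. y j \<noteq> 0} = {}"
      by blast
    then show ?thesis using that[OF x] by (metis finite.emptyI)
  qed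
qed

section \<open>Coordinates\<close>

text \<open>Linear algebra with polynomials takes its scalars from a type of class
  \<open>field\<close>, whereas \<open>K\<close> is a set of complex numbers. The map
  \<open>emb\<close> links the two; it will be \<open>complex_of_real\<close> or the
  identity.\<close>

locale field_embedding =
  fixes K :: "complex set" and emb :: "'k::field \<Rightarrow> complex"
  assumes inj_emb: "inj emb" and range_emb: "range emb = K"
    and emb_1 [simp]: "emb 1 = 1"
    and emb_add [simp]: "emb (a + b) = emb a + emb b"
    and emb_mult [simp]: "emb (a * b) = emb a * emb b"
begin

lemma emb_0 [simp]: "emb 0 = 0"
  using emb_add[of 0 0] by simp

lemma emb_mem [simp, intro]: "emb a \<in> K"
  using range_emb by blast

definition lin_comb :: "(complex, 'e) module \<Rightarrow> 'e set \<Rightarrow> ('e \<Rightarrow> 'k) \<Rightarrow> 'e"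
  where "lin_comb V B a = (\<Oplus>\<^bsub>V\<^esub>b\<in>B. emb (a b) \<odot>\<^bsub>V\<^esub> b)"

context
  fixes V :: "(complex, 'e) module" (structure)
  assumes V: "module (scalar_field K) V"
begin

interpretation V: Module.module "scalar_field K" V by (rule V)

lemma lin_comb_closed [simp, intro]: "B \<subseteq> carrier V \<Longrightarrow> lin_comb V B a \<in> carrier V"
  unfolding lin_comb_def by (rule V.M.finsum_closed) auto

lemma lin_comb_add:
  assumes "B \<subseteq> carrier V"
  shows "lin_comb V B (\<lambda>b. a b + c b) = lin_comb V B a \<oplus> lin_comb V B c"
proof -
  have "lin_comb V B (\<lambda>b. a b + c b) = (\<Oplus>b\<in>B. emb (a b) \<odot> b \<oplus> emb (c b) \<odot> b)"
    unfolding lin_comb_def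
    by (rule V.M.finsum_cong') (use assms V.smult_l_distr in auto)
  also have "\<dots> = lin_comb V B a \<oplus> lin_comb V B c"
    unfolding lin_comb_def by (rule V.M.finsum_addf) (use assms in auto)
  finally show ?thesis .
qed

lemma lin_comb_scale:
  assumes "finite B" "B \<subseteq> carrier V"
  shows "lin_comb V B (\<lambda>b. s * a b) = emb s \<odot> lin_comb V B a"
proof -
  have "lin_comb V B (\<lambda>b. s * a b) = (\<Oplus>b\<in>B. emb s \<odot> (emb (a b) \<odot> b))"
    unfolding lin_comb_def
    by (rule V.M.finsum_cong') (use assms V.smult_assoc1 in auto)
  also have "\<dots> = emb s \<odot> lin_comb V B a"
    unfolding lin_comb_def
    by (rule V.finsum_smult_ldistr[symmetric]) (use assms in auto)
  finally show ?thesis .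
qed

lemma lin_comb_insert:
  assumes "finite B" "b \<notin> B" "insert b B \<subseteq> carrier V"
  shows "lin_comb V (insert b B) a = emb (a b) \<odot> b \<oplus> lin_comb V B a"
  unfolding lin_comb_def by (rule V.M.finsum_insert) (use assms in auto)

text \<open>A spanning set with the least number of elements is a basis: a relation with a nonzero
  coefficient at \<open>b\<close> allows \<open>b\<close> to be removed from every combination,
  which leaves a smaller spanning set.\<close>

lemma finite_dimensional_basis:
  assumes "finite_dimensional K V"
  obtains B where "finite B" "B \<subseteq> carrier V" "\<And>v. v \<in> carrier V \<Longrightarrow> \<exists>a. v = lin_comb V B a"
    "\<And>a c b. lin_comb V B a = lin_comb V B c \<Longrightarrow> b \<in> B \<Longrightarrow> a b = c b"
proof -
  define sp where "sp B \<longleftrightarrow> finite B \<and> B \<subseteq> carrier V \<and> (\<forall>v\<in>carrier V. \<exists>a. v = lin_comb V B a)" for B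
  obtain B0 where B0: "finite B0" "B0 \<subseteq> carrier V"
    "\<forall>v\<in>carrier V. \<exists>c\<in>B0 \<rightarrow> K. v = (\<Oplus>b\<in>B0. c b \<odot> b)"
    using assms unfolding finite_dimensional_def by blast
  have "sp B0"
    unfolding sp_def
  proof (intro conjI ballI)
    fix v assume "v \<in> carrier V"
    then obtain c where c: "c \<in> B0 \<rightarrow> K" "v = (\<Oplus>b\<in>B0. c b \<odot> b)"
      using B0 by blast
    have "v = lin_comb V B0 (\<lambda>b. inv_into UNIV emb (c b))"
      unfolding c(2) lin_comb_def
    proof (rule V.M.finsum_cong')
      fix b assume "b \<in> B0"
      then have "c b \<in> range emb" using c(1) range_emb by auto
      then show "c b \<odot> b = emb (inv_into UNIV emb (c b)) \<odot> b" by (simp add: f_inv_into_f)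
    qed (use B0 in auto)
    then show "\<exists>a. v = lin_comb V B0 a" by blast
  qed (use B0 in auto)
  then obtain B where B: "sp B" and minB: "\<And>C. sp C \<Longrightarrow> card B \<le> card C"
    by (metis arg_min_nat_lemma[of sp B0 card])
  then have fin: "finite B" and sub: "B \<subseteq> carrier V"
    by (auto simp: sp_def)
  have ker: "a b = 0" if a: "lin_comb V B a = \<zero>" and b: "b \<in> B" for a b
  proof (rule ccontr)
    assume nz: "a b \<noteq> 0"
    define C where "C = B - {b}"
    have C: "finite C" "b \<notin> C" "B = insert b C" "C \<subseteq> carrier V" "b \<in> carrier V"
      using fin sub b by (auto simp: C_def)
    have "sp C"
      unfolding sp_def
    proof (intro conjI ballI)
      fix v assume "v \<in> carrier V"
      then obtain c where c: "v = lin_comb V B c"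
        using B by (auto simp: sp_def)
      \<comment> \<open>This multiple of the relation cancels the coefficient of \<open>v\<close> at
        \<open>b\<close>.\<close>
      define t where "t = - c b / a b"
      have "v = lin_comb V B c \<oplus> emb t \<odot> lin_comb V B a"
        using c a sub by simp
      also have "\<dots> = lin_comb V B (\<lambda>x. c x + t * a x)"
        using fin sub by (simp add: lin_comb_add lin_comb_scale)
      also have "\<dots> = emb (c b + t * a b) \<odot> b \<oplus> lin_comb V C (\<lambda>x. c x + t * a x)"
        unfolding C(3) by (rule lin_comb_insert) (use C in auto)
      also have "c b + t * a b = 0"
        using nz by (simp add: t_def)
      also have "emb 0 \<odot> b \<oplus> lin_comb V C (\<lambda>x. c x + t * a x) = lin_comb V C (\<lambda>x. c x + t * a x)"
        using V.smult_l_null[of b] C by simp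
      finally show "\<exists>a. v = lin_comb V C a" by blast
    qed (use C in auto)
    then have "card B \<le> card C" by (rule minB)
    then show False using C by simp
  qed
  show ?thesis
  proof (rule that[OF fin sub])
    show "\<exists>a. v = lin_comb V B a" if "v \<in> carrier V" for v
      using B that by (auto simp: sp_def)
    fix a c b assume eq: "lin_comb V B a = lin_comb V B c" and b: "b \<in> B"
    have "lin_comb V B (\<lambda>x. a x + (- 1) * c x) = lin_comb V B c \<oplus> emb (-1) \<odot> lin_comb V B c"
      using fin sub eq by (simp only: lin_comb_add lin_comb_scale)
    also have "\<dots> = lin_comb V B (\<lambda>x. c x + (- 1) * c x)"
      using fin sub by (simp only: lin_comb_add lin_comb_scale)
    also have "\<dots> = lin_comb V B (\<lambda>x. 0 * c x)" by simp
    also have "\<dots> = \<zero>"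
      using fin sub V.smult_l_null by (simp only: lin_comb_scale emb_0) auto
    finally have "a b + (- 1) * c b = 0"
      using ker b by blast
    then show "a b = c b" by simp
  qed
qed

lemma finite_dimensional_coordinates:
  assumes "finite_dimensional K V"
  obtains B and \<kappa> :: "'e \<Rightarrow> 'e \<Rightarrow> 'k" where "finite B"
    "\<And>b x y. b \<in> B \<Longrightarrow> x \<in> carrier V \<Longrightarrow> y \<in> carrier V \<Longrightarrow> \<kappa> b (x \<oplus> y) = \<kappa> b x + \<kappa> b y"
    "\<And>b s x. b \<in> B \<Longrightarrow> x \<in> carrier V \<Longrightarrow> \<kappa> b (emb s \<odot> x) = s * \<kappa> b x"
    "\<And>x y. x \<in> carrier V \<Longrightarrow> y \<in> carrier V \<Longrightarrow> (\<And>b. b \<in> B \<Longrightarrow> \<kappa> b x = \<kappa> b y) \<Longrightarrow> x = y"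
    "\<And>f. \<exists>x\<in>carrier V. \<forall>b\<in>B. \<kappa> b x = f b"
proof -
  obtain B where B: "finite B" "B \<subseteq> carrier V" and ex: "\<And>v. v \<in> carrier V \<Longrightarrow> \<exists>a. v = lin_comb V B a"
    and uniq: "\<And>a c b. lin_comb V B a = lin_comb V B c \<Longrightarrow> b \<in> B \<Longrightarrow> a b = c b"
    using finite_dimensional_basis[OF assms] by metis
  \<comment> \<open>The chosen coefficients are determined only at members of \<open>B\<close>,
    whence all properties of \<kappa> are restricted to these.\<close>
  define \<kappa> where "\<kappa> b v = (SOME a. v = lin_comb V B a) b" for b v
  have \<kappa>: "v = lin_comb V B (\<lambda>b. \<kappa> b v)" if "v \<in> carrier V" for v
    unfolding \<kappa>_def using someI_ex[OF ex[OF that]] by simp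
  have \<kappa>_eq: "\<kappa> b (lin_comb V B a) = a b" if "b \<in> B" for a b
    using uniq[OF _ that] \<kappa>[OF lin_comb_closed[OF B(2)]] by metis
  show ?thesis
  proof (rule that[OF B(1)])
    show "\<kappa> b (x \<oplus> y) = \<kappa> b x + \<kappa> b y"
      if "b \<in> B" "x \<in> carrier V" "y \<in> carrier V" for b x y
      using \<kappa>_eq[OF that(1)] \<kappa> that lin_comb_add[OF B(2)] by metis
    show "\<kappa> b (emb s \<odot> x) = s * \<kappa> b x" if "b \<in> B" "x \<in> carrier V" for b s x
      using \<kappa>_eq[OF that(1)] \<kappa> that lin_comb_scale[OF B] by metis
    show "x = y" if "x \<in> carrier V" "y \<in> carrier V" "\<And>b. b \<in> B \<Longrightarrow> \<kappa> b x = \<kappa> b y" for x y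
    proof -
      have "lin_comb V B (\<lambda>b. \<kappa> b x) = lin_comb V B (\<lambda>b. \<kappa> b y)"
        unfolding lin_comb_def
        by (rule V.M.finsum_cong') (use B that(3) in auto)
      then show ?thesis using \<kappa> that by metis
    qed
    show "\<exists>x\<in>carrier V. \<forall>b\<in>B. \<kappa> b x = f b" for f
      using \<kappa>_eq lin_comb_closed[OF B(2)] by blast
  qed
qed

end

end

section \<open>Neighbourhoods of 0 in the product\<close>

locale finite_dimensional_product = field_embedding K emb
  for K :: "complex set" and emb :: "'k::field \<Rightarrow> complex" +
  fixes I :: "'i set" and E :: "'i \<Rightarrow> (complex, 'e) module" and nrm :: "'i \<Rightarrow> 'e \<Rightarrow> real"
  assumes K: "K = \<real> \<or> K = UNIV"
    and countable_I: "countable I" and infinite_I: "infinite I"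
    and normed: "\<And>i. i \<in> I \<Longrightarrow> normed_space_over K (E i) (nrm i)"
    and finite_dim: "\<And>i. i \<in> I \<Longrightarrow> finite_dimensional K (E i)"
    and nonzero: "\<And>i. i \<in> I \<Longrightarrow> carrier (E i) \<noteq> {\<zero>\<^bsub>E i\<^esub>}"
begin

abbreviation "X \<equiv> product_module I E"
abbreviation "\<tau> \<equiv> product_topology (\<lambda>i. norm_topology (E i) (nrm i)) I"

lemma module_E: "i \<in> I \<Longrightarrow> module (scalar_field K) (E i)"
  using normed by (simp add: normed_space_over_def)

lemma topspace_\<tau>: "topspace \<tau> = carrier X"
  by (rule topspace_product_norm_topology[OF K normed])

sublocale X: Module.module "scalar_field K" X
  by (rule module_product_module[OF K module_E])

lemma X_component:
  "x \<in> carrier X \<Longrightarrow> i \<in> I \<Longrightarrow> x i \<in> carrier (E i)"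
  "i \<in> I \<Longrightarrow> \<zero>\<^bsub>X\<^esub> i = \<zero>\<^bsub>E i\<^esub>"
  "i \<in> I \<Longrightarrow> (a \<odot>\<^bsub>X\<^esub> x) i = a \<odot>\<^bsub>E i\<^esub> x i"
  by (auto simp: product_module_def PiE_iff)

lemma norm_dist_zero:
  assumes i: "i \<in> I" and v: "v \<in> carrier (E i)"
  shows "norm_dist (E i) (nrm i) \<zero>\<^bsub>E i\<^esub> v = nrm i v"
proof -
  interpret N: normed_space_over K "E i" "nrm i" by (rule normed[OF i])
  have eq: "v \<ominus>\<^bsub>E i\<^esub> \<zero>\<^bsub>E i\<^esub> = v"
    using v by (simp only: N.M.minus_eq) simp
  interpret M: Metric_space "carrier (E i)" "norm_dist (E i) (nrm i)"
    by (rule N.Metric_space_norm_dist[OF K])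
  have "norm_dist (E i) (nrm i) \<zero>\<^bsub>E i\<^esub> v = norm_dist (E i) (nrm i) v \<zero>\<^bsub>E i\<^esub>"
    by (rule M.commute)
  then show ?thesis
    using v by (simp add: norm_dist_def eq)
qed

text \<open>A basic open box restricts only finitely many components, and each factor of a box
  around 0 contains a norm ball about 0.\<close>

lemma zero_neighbourhood:
  assumes "openin \<tau> U" "\<zero>\<^bsub>X\<^esub> \<in> U"
  obtains F \<epsilon> where "finite F" "F \<subseteq> I" "\<epsilon> > 0"
    "\<And>x. x \<in> carrier X \<Longrightarrow> (\<And>i. i \<in> F \<Longrightarrow> nrm i (x i) < \<epsilon>) \<Longrightarrow> x \<in> U"
proof -
  obtain W where W: "finite {i \<in> I. W i \<noteq> topspace (norm_topology (E i) (nrm i))}"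
    "\<forall>i\<in>I. openin (norm_topology (E i) (nrm i)) (W i)" "\<zero>\<^bsub>X\<^esub> \<in> Pi\<^sub>E I W" "Pi\<^sub>E I W \<subseteq> U"
    using assms unfolding openin_product_topology_alt by blast
  define F where "F = {i \<in> I. W i \<noteq> topspace (norm_topology (E i) (nrm i))}"
  have "\<exists>e>0. \<forall>v\<in>carrier (E i). nrm i v < e \<longrightarrow> v \<in> W i" if i: "i \<in> I" for i
  proof -
    interpret N: normed_space_over K "E i" "nrm i" by (rule normed[OF i])
    interpret M: Metric_space "carrier (E i)" "norm_dist (E i) (nrm i)"
      by (rule N.Metric_space_norm_dist[OF K])
    have "\<zero>\<^bsub>E i\<^esub> \<in> W i" using W(3) i X_component(2)[OF i] by (metis PiE_mem)
    moreover have "openin M.mtopology (W i)"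
      using W(2) i by (simp add: norm_topology_def)
    ultimately obtain e where e: "e > 0" "M.mball \<zero>\<^bsub>E i\<^esub> e \<subseteq> W i"
      unfolding M.openin_mtopology by blast
    have "v \<in> W i" if v: "v \<in> carrier (E i)" "nrm i v < e" for v
    proof -
      show ?thesis using v e norm_dist_zero[OF i v(1)] by auto
    qed
    with e show ?thesis by blast
  qed
  then obtain e where e: "\<And>i. i \<in> I \<Longrightarrow> e i > 0"
    "\<And>i v. i \<in> I \<Longrightarrow> v \<in> carrier (E i) \<Longrightarrow> nrm i v < e i \<Longrightarrow> v \<in> W i" by metis
  have F: "finite F" "F \<subseteq> I" using W(1) by (auto simp: F_def)
  \<comment> \<open>The element 1 keeps the minimum meaningful when \<open>F\<close> is
    empty.\<close>
  define \<epsilon> where "\<epsilon> = Min (insert 1 (e ` F))"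
  show ?thesis
  proof (rule that[OF F])
    show "\<epsilon> > 0" using F e(1) by (auto simp: \<epsilon>_def)
    fix x assume x: "x \<in> carrier X" and small: "\<And>i. i \<in> F \<Longrightarrow> nrm i (x i) < \<epsilon>"
    have "x i \<in> W i" if i: "i \<in> I" for i
    proof (cases "i \<in> F")
      case True
      then have "\<epsilon> \<le> e i" using F by (simp add: \<epsilon>_def)
      then show ?thesis using e(2)[OF i X_component(1)[OF x i]] small[OF True] by simp
    next
      case False
      have "x \<in> topspace \<tau>" using x topspace_\<tau> by simp
      then show ?thesis using False i by (auto simp: F_def PiE_iff)
    qed
    then have "x \<in> Pi\<^sub>E I W" using x by (auto simp: product_module_def PiE_iff)
    then show "x \<in> U" using W(4) by blast
  qed
qed

lemma linear_operator_zero: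
  assumes "linear_operator K X T"
  shows "T \<zero>\<^bsub>X\<^esub> = \<zero>\<^bsub>X\<^esub>"
proof -
  have "T (emb 0 \<odot>\<^bsub>X\<^esub> \<zero>\<^bsub>X\<^esub>) = emb 0 \<odot>\<^bsub>X\<^esub> T \<zero>\<^bsub>X\<^esub>" "T \<zero>\<^bsub>X\<^esub> \<in> carrier X"
    using assms emb_mem[of 0] X.zero_closed unfolding linear_operator_def by blast+
  then show ?thesis
    using X.smult_l_null emb_mem[of 0] X.smult_r_null[of "emb 0"] by simp
qed

text \<open>A nonzero vector can be rescaled to norm 1 by a positive real number, which belongs to
  \<open>K\<close> in both cases.\<close>

lemma norm_vanishes_if_multiples_bounded:
  assumes i: "i \<in> I" and v: "v \<in> carrier (E i)" and bd: "\<And>c. c \<in> K \<Longrightarrow> nrm i (c \<odot>\<^bsub>E i\<^esub> v) < 1"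
  shows "v = \<zero>\<^bsub>E i\<^esub>"
proof (rule ccontr)
  interpret N: normed_space_over K "E i" "nrm i" by (rule normed[OF i])
  assume "v \<noteq> \<zero>\<^bsub>E i\<^esub>"
  then have pos: "nrm i v > 0"
    using N.nrm_nonneg[OF v] N.nrm_eq_0_iff[OF v] by linarith
  have mem: "complex_of_real (1 / nrm i v) \<in> K" using K by auto
  have "nrm i (complex_of_real (1 / nrm i v) \<odot>\<^bsub>E i\<^esub> v) = 1"
    using pos by (simp only: N.nrm_smult[OF mem v] norm_of_real) simp
  with bd[OF mem] show False by simp
qed

text \<open>A neighbourhood of 0 contains the subspace of all \<open>x\<close> vanishing on a finite \<open>F \<subseteq> I\<close>, and
  a subspace with a norm-bounded \<open>i\<close>-th component under \<open>T\<close> has that component 0.\<close>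

lemma continuous_operator_finitely_determined:
  assumes lin: "linear_operator K X T" and cont: "continuous_map \<tau> \<tau> T" and i: "i \<in> I"
  obtains F where "finite F" "F \<subseteq> I"
    "\<And>x. x \<in> carrier X \<Longrightarrow> (\<And>l. l \<in> F \<Longrightarrow> x l = \<zero>\<^bsub>E l\<^esub>) \<Longrightarrow> T x i = \<zero>\<^bsub>E i\<^esub>"
proof -
  interpret N: normed_space_over K "E i" "nrm i" by (rule normed[OF i])
  interpret M: Metric_space "carrier (E i)" "norm_dist (E i) (nrm i)"
    by (rule N.Metric_space_norm_dist[OF K])
  have "continuous_map \<tau> (norm_topology (E i) (nrm i)) (\<lambda>x. x i)"
    by (rule continuous_map_product_projection[OF i])
  then have "continuous_map \<tau> (norm_topology (E i) (nrm i)) ((\<lambda>x. x i) \<circ> T)"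
    using cont by (rule continuous_map_compose[rotated])
  then have op: "openin \<tau> {x \<in> topspace \<tau>. T x i \<in> M.mball \<zero>\<^bsub>E i\<^esub> 1}" (is "openin \<tau> ?U")
    unfolding norm_topology_def[of "E i"] o_def by (rule openin_continuous_map_preimage) simp
  have "\<zero>\<^bsub>X\<^esub> \<in> ?U"
    using linear_operator_zero[OF lin] topspace_\<tau> X_component(2)[OF i] by simp
  with op obtain F \<epsilon> where F: "finite F" "F \<subseteq> I" "\<epsilon> > 0"
    "\<And>x. x \<in> carrier X \<Longrightarrow> (\<And>i. i \<in> F \<Longrightarrow> nrm i (x i) < \<epsilon>) \<Longrightarrow> x \<in> ?U"
    by (rule zero_neighbourhood) blast
  show ?thesis
  proof (rule that[OF F(1,2)])
    fix x assume x: "x \<in> carrier X" and x0: "\<And>l. l \<in> F \<Longrightarrow> x l = \<zero>\<^bsub>E l\<^esub>"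
    have Tx: "T x \<in> carrier X" using lin x by (auto simp: linear_operator_def)
    show "T x i = \<zero>\<^bsub>E i\<^esub>"
    proof (rule norm_vanishes_if_multiples_bounded[OF i X_component(1)[OF Tx i]])
      fix c assume c: "c \<in> K"
      have cx: "c \<odot>\<^bsub>X\<^esub> x \<in> carrier X" using c x by simp
      have "nrm l ((c \<odot>\<^bsub>X\<^esub> x) l) < \<epsilon>" if l: "l \<in> F" for l
      proof -
        have lI: "l \<in> I" using l F by blast
        interpret L: normed_space_over K "E l" "nrm l" by (rule normed[OF lI])
        have "(c \<odot>\<^bsub>X\<^esub> x) l = \<zero>\<^bsub>E l\<^esub>"
          using x0[OF l] X_component(3)[OF lI] L.smult_r_null[of c] c by simp
        then show ?thesis using L.nrm_eq_0_iff[of "\<zero>\<^bsub>E l\<^esub>"] F(3) by simp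
      qed
      with F(4)[OF cx] have "T (c \<odot>\<^bsub>X\<^esub> x) i \<in> M.mball \<zero>\<^bsub>E i\<^esub> 1" by blast
      moreover have "T (c \<odot>\<^bsub>X\<^esub> x) i = c \<odot>\<^bsub>E i\<^esub> T x i"
        using lin c x X_component(3)[OF i] by (simp add: linear_operator_def)
      ultimately show "nrm i (c \<odot>\<^bsub>E i\<^esub> T x i) < 1"
        using norm_dist_zero[OF i, of "c \<odot>\<^bsub>E i\<^esub> T x i"] by simp
    qed
  qed
qed

text \<open>The metric enters only through its ball about 0, and hence through finitely many
  components. There the vectors of \<open>S\<close> have bounded norms, since all but finitely many
  of them vanish in these components; one scalar then shrinks all of \<open>S\<close> at
  once.\<close>

lemma bounded_set_shrinks_into_ball:
  assumes d: "compatible_metric \<tau> d" and \<delta>: "\<delta> > 0"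
  obtains F where "finite F" "F \<subseteq> I"
    "\<And>S. S \<subseteq> carrier X \<Longrightarrow> finite {y \<in> S. \<exists>i\<in>F. y i \<noteq> \<zero>\<^bsub>E i\<^esub>} \<Longrightarrow>
      \<exists>c\<in>K - {0}. \<forall>y\<in>S. d (c \<odot>\<^bsub>X\<^esub> y) \<zero>\<^bsub>X\<^esub> < \<delta>"
proof -
  interpret d: Metric_space "carrier X" d
    using d unfolding compatible_metric_def topspace_\<tau> by blast
  have "d.mtopology = \<tau>"
    using d unfolding compatible_metric_def topspace_\<tau> by blast
  then have "openin \<tau> (d.mball \<zero>\<^bsub>X\<^esub> \<delta>)" using d.openin_mball by metis
  moreover have "\<zero>\<^bsub>X\<^esub> \<in> d.mball \<zero>\<^bsub>X\<^esub> \<delta>" using \<delta> by simp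
  ultimately obtain F \<epsilon> where F: "finite F" "F \<subseteq> I" "\<epsilon> > 0"
    "\<And>x. x \<in> carrier X \<Longrightarrow> (\<And>i. i \<in> F \<Longrightarrow> nrm i (x i) < \<epsilon>) \<Longrightarrow> x \<in> d.mball \<zero>\<^bsub>X\<^esub> \<delta>"
    by (rule zero_neighbourhood) blast
  show ?thesis
  proof (rule that[OF F(1,2)])
    fix S assume S: "S \<subseteq> carrier X" and fin: "finite {y \<in> S. \<exists>i\<in>F. y i \<noteq> \<zero>\<^bsub>E i\<^esub>}" (is "finite ?Q")
    define B where "B = (\<Sum>(y, i)\<in>?Q \<times> F. \<bar>nrm i (y i)\<bar>)"
    have B: "nrm i (y i) \<le> B" if y: "y \<in> S" and i: "i \<in> F" for y i
    proof (cases "y i = \<zero>\<^bsub>E i\<^esub>")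
      case True
      have iI: "i \<in> I" using i F by blast
      interpret N: normed_space_over K "E i" "nrm i" by (rule normed[OF iI])
      have "nrm i (y i) = 0" using N.nrm_eq_0_iff[of "\<zero>\<^bsub>E i\<^esub>"] True by simp
      moreover have "B \<ge> 0" unfolding B_def by (rule sum_nonneg) auto
      ultimately show ?thesis by simp
    next
      case False
      then have "(y, i) \<in> ?Q \<times> F" using y i by blast
      then have "(\<lambda>(y, i). \<bar>nrm i (y i)\<bar>) (y, i) \<le> B"
        unfolding B_def by (rule member_le_sum) (use fin F(1) in auto)
      then show ?thesis by simp
    qed
    have B0: "B \<ge> 0" unfolding B_def by (rule sum_nonneg) auto
    \<comment> \<open>The summand 1 avoids division by 0 and makes \<open>t * B < \<epsilon>\<close>
      strict.\<close>
    define t where "t = \<epsilon> / (B + 1)"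
    have t: "t > 0" "t * B < \<epsilon>"
      using F(3) B0 by (auto simp: t_def field_simps)
    define c where "c = complex_of_real t"
    have c: "c \<in> K - {0}" using K t by (auto simp: c_def)
    have "d (c \<odot>\<^bsub>X\<^esub> y) \<zero>\<^bsub>X\<^esub> < \<delta>" if y: "y \<in> S" for y
    proof -
      have cy: "c \<odot>\<^bsub>X\<^esub> y \<in> carrier X" using c S y by auto
      have "nrm i ((c \<odot>\<^bsub>X\<^esub> y) i) < \<epsilon>" if i: "i \<in> F" for i
      proof -
        have iI: "i \<in> I" using i F by blast
        interpret N: normed_space_over K "E i" "nrm i" by (rule normed[OF iI])
        have "nrm i ((c \<odot>\<^bsub>X\<^esub> y) i) = t * nrm i (y i)"
          using N.nrm_smult[of c "y i"] c t X_component(1)[of y i] S y iI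
          by (auto simp: X_component(3)[OF iI] c_def)
        also have "\<dots> \<le> t * B" using B[OF y i] t by simp
        finally show ?thesis using t by simp
      qed
      then have "c \<odot>\<^bsub>X\<^esub> y \<in> d.mball \<zero>\<^bsub>X\<^esub> \<delta>" using F(4)[OF cy] by blast
      then show ?thesis using d.commute by simp
    qed
    with c show "\<exists>c\<in>K - {0}. \<forall>y\<in>S. d (c \<odot>\<^bsub>X\<^esub> y) \<zero>\<^bsub>X\<^esub> < \<delta>" by blast
  qed
qed

end

section \<open>One sequence of coordinates for the whole product\<close>

text \<open>The last two assumptions are the finite-dependence form of continuity for \<Phi> and for
  its inverse. Through them continuous operators turn into row-finite ones.\<close>

locale coordinatized_product = finite_dimensional_product K emb I E nrm
  for K :: "complex set" and emb :: "'k::field \<Rightarrow> complex" and I :: "'i set"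
    and E :: "'i \<Rightarrow> (complex, 'e) module" and nrm :: "'i \<Rightarrow> 'e \<Rightarrow> real" +
  fixes \<Phi> :: "('i \<Rightarrow> 'e) \<Rightarrow> nat \<Rightarrow> 'k"
  assumes bij_\<Phi>: "bij_betw \<Phi> (carrier X) UNIV"
    and \<Phi>_add: "\<lbrakk>x \<in> carrier X; y \<in> carrier X\<rbrakk> \<Longrightarrow> \<Phi> (x \<oplus>\<^bsub>X\<^esub> y) = (\<lambda>j. \<Phi> x j + \<Phi> y j)"
    and \<Phi>_scale: "x \<in> carrier X \<Longrightarrow> \<Phi> (emb s \<odot>\<^bsub>X\<^esub> x) = (\<lambda>j. s * \<Phi> x j)"
    and \<Phi>_finitely_determined: "\<exists>F. finite F \<and> F \<subseteq> I \<and>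
      (\<forall>x\<in>carrier X. (\<forall>i\<in>F. x i = \<zero>\<^bsub>E i\<^esub>) \<longrightarrow> (\<forall>j<N. \<Phi> x j = 0))"
    and \<Phi>_finitely_determines: "finite F \<Longrightarrow> F \<subseteq> I \<Longrightarrow>
      \<exists>N. \<forall>x\<in>carrier X. (\<forall>j<N. \<Phi> x j = 0) \<longrightarrow> (\<forall>i\<in>F. x i = \<zero>\<^bsub>E i\<^esub>)"

text \<open>The disjoint union of the finite coordinate sets of the factors is countably infinite;
  an enumeration of it arranges all coordinates in one sequence.\<close>

lemma (in finite_dimensional_product) exists_coordinates:
  obtains \<Phi> where "coordinatized_product K emb I E nrm \<Phi>"
proof -
  have "\<exists>(B :: 'e set) (\<kappa> :: 'e \<Rightarrow> 'e \<Rightarrow> 'k). finite B \<and>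
      (\<forall>b\<in>B. \<forall>x\<in>carrier (E i). \<forall>y\<in>carrier (E i).
        \<kappa> b (x \<oplus>\<^bsub>E i\<^esub> y) = \<kappa> b x + \<kappa> b y) \<and>
      (\<forall>b\<in>B. \<forall>s. \<forall>x\<in>carrier (E i). \<kappa> b (emb s \<odot>\<^bsub>E i\<^esub> x) = s * \<kappa> b x) \<and>
      (\<forall>x\<in>carrier (E i). \<forall>y\<in>carrier (E i). (\<forall>b\<in>B. \<kappa> b x = \<kappa> b y) \<longrightarrow> x = y) \<and>
      (\<forall>f. \<exists>x\<in>carrier (E i). \<forall>b\<in>B. \<kappa> b x = f b)" (is "\<exists>(B :: 'e set) \<kappa>. ?P i B \<kappa>") if i: "i \<in> I" for i
  proof -
    obtain B and \<kappa> :: "'e \<Rightarrow> 'e \<Rightarrow> 'k" where "finite B"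
      "\<And>b x y. b \<in> B \<Longrightarrow> x \<in> carrier (E i) \<Longrightarrow> y \<in> carrier (E i) \<Longrightarrow>
        \<kappa> b (x \<oplus>\<^bsub>E i\<^esub> y) = \<kappa> b x + \<kappa> b y"
      "\<And>b s x. b \<in> B \<Longrightarrow> x \<in> carrier (E i) \<Longrightarrow> \<kappa> b (emb s \<odot>\<^bsub>E i\<^esub> x) = s * \<kappa> b x"
      "\<And>x y. x \<in> carrier (E i) \<Longrightarrow> y \<in> carrier (E i) \<Longrightarrow>
        (\<And>b. b \<in> B \<Longrightarrow> \<kappa> b x = \<kappa> b y) \<Longrightarrow> x = y"
      "\<And>f. \<exists>x\<in>carrier (E i). \<forall>b\<in>B. \<kappa> b x = f b"
      using finite_dimensional_coordinates[OF module_E[OF i] finite_dim[OF i]] by blast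
    then have "?P i B \<kappa>" by simp
    then show ?thesis by blast
  qed
  then have "\<forall>i\<in>I. \<exists>B \<kappa>. ?P i B \<kappa>" by (rule ballI)
  from bchoice[OF this] obtain B where "\<forall>i\<in>I. \<exists>\<kappa>. ?P i (B i) \<kappa>" by (rule exE)
  from bchoice[OF this] obtain \<kappa> where "\<forall>i\<in>I. ?P i (B i) (\<kappa> i)" by (rule exE)
  then have finB: "\<And>i. i \<in> I \<Longrightarrow> finite (B i)"
    and \<kappa>_add: "\<And>i b x y. \<lbrakk>i \<in> I; b \<in> B i; x \<in> carrier (E i); y \<in> carrier (E i)\<rbrakk> \<Longrightarrow>
      \<kappa> i b (x \<oplus>\<^bsub>E i\<^esub> y) = \<kappa> i b x + \<kappa> i b y"
    and \<kappa>_scale: "\<And>i b s x. \<lbrakk>i \<in> I; b \<in> B i; x \<in> carrier (E i)\<rbrakk> \<Longrightarrow>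
      \<kappa> i b (emb s \<odot>\<^bsub>E i\<^esub> x) = s * \<kappa> i b x"
    and \<kappa>_inj: "\<And>i x y. \<lbrakk>i \<in> I; x \<in> carrier (E i); y \<in> carrier (E i); \<forall>b\<in>B i. \<kappa> i b x = \<kappa> i b y\<rbrakk> \<Longrightarrow> x = y"
    and \<kappa>_surj: "\<And>i f. i \<in> I \<Longrightarrow> \<exists>x\<in>carrier (E i). \<forall>b\<in>B i. \<kappa> i b x = f b"
    by simp_all
  have zero: "\<zero>\<^bsub>E i\<^esub> \<in> carrier (E i)" if "i \<in> I" for i
    using module.axioms(2)[OF module_E[OF that]] by (rule abelian_group.axioms(1)[THEN abelian_monoid.zero_closed])
  have \<kappa>_zero: "\<kappa> i b \<zero>\<^bsub>E i\<^esub> = 0" if "i \<in> I" "b \<in> B i" for i b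
  proof -
    interpret Ei: Module.module "scalar_field K" "E i" by (rule module_E[OF that(1)])
    show ?thesis
      using \<kappa>_scale[OF that zero[OF that(1)], of 0] Ei.smult_r_null[of "emb 0"] emb_mem[of 0] by simp
  qed
  \<comment> \<open>A nonzero factor has at least one coordinate; hence the disjoint union
    \<open>J\<close> below projects onto \<open>I\<close> and is infinite.\<close>
  have Bne: "B i \<noteq> {}" if i: "i \<in> I" for i
  proof
    assume "B i = {}"
    then have "carrier (E i) \<subseteq> {\<zero>\<^bsub>E i\<^esub>}"
      using \<kappa>_inj[OF i] zero[OF i] by auto
    then show False using nonzero[OF i] zero[OF i] by blast
  qed
  define J where "J = Sigma I B"
  have "fst ` J = I" using Bne by (force simp: J_def)
  then have "infinite J" using infinite_I finite_imageI by metis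
  moreover have "countable J"
    unfolding J_def using countable_I finB by (intro countable_SIGMA) (auto intro: countable_finite)
  ultimately have g_bij: "bij_betw (from_nat_into J) UNIV J"
    by (simp add: bij_betw_from_nat_into)
  define g where "g = from_nat_into J"
  have g_mem: "fst (g j) \<in> I" "snd (g j) \<in> B (fst (g j))" for j
  proof -
    have "g j \<in> Sigma I B" using bij_betwE[OF g_bij] by (simp add: g_def J_def)
    then show "fst (g j) \<in> I" "snd (g j) \<in> B (fst (g j))" by auto
  qed
  obtain h where h: "\<And>i b. i \<in> I \<Longrightarrow> b \<in> B i \<Longrightarrow> g (h i b) = (i, b)"
  proof
    fix i b assume "i \<in> I" "b \<in> B i"
    then have "(i, b) \<in> range g" using g_bij by (auto simp: J_def g_def bij_betw_def)
    then show "g (inv_into UNIV g (i, b)) = (i, b)" by (rule f_inv_into_f)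
  qed
  define \<Phi> where "\<Phi> x j = \<kappa> (fst (g j)) (snd (g j)) (x (fst (g j)))" for x j
  have \<Phi>_h: "\<Phi> x (h i b) = \<kappa> i b (x i)" if "i \<in> I" "b \<in> B i" for x i b
    using h[OF that] by (simp add: \<Phi>_def)
  note X_simps = product_module_def PiE_iff
  show ?thesis
  proof (rule that, unfold_locales)
    show "bij_betw \<Phi> (carrier X) UNIV"
    proof -
      have "\<exists>x\<in>carrier X. \<Phi> x = f" for f
      proof -
        have "\<forall>i. \<exists>x. i \<in> I \<longrightarrow> x \<in> carrier (E i) \<and> (\<forall>b\<in>B i. \<kappa> i b x = f (h i b))"
          using \<kappa>_surj[of _ "\<lambda>b. f (h _ b)"] by meson
        then obtain x0 where x0: "\<And>i. i \<in> I \<Longrightarrow> x0 i \<in> carrier (E i)"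
          "\<And>i b. i \<in> I \<Longrightarrow> b \<in> B i \<Longrightarrow> \<kappa> i b (x0 i) = f (h i b)" by metis
        define x where "x = restrict x0 I"
        have "\<Phi> x j = f j" for j
        proof -
          have "g (h (fst (g j)) (snd (g j))) = g j"
            using h[OF g_mem] by simp
          then have "h (fst (g j)) (snd (g j)) = j"
            using g_bij by (auto simp: g_def bij_betw_def dest: injD)
          then show ?thesis
            using x0(2)[OF g_mem] g_mem by (simp add: \<Phi>_def x_def)
        qed
        moreover have "x \<in> carrier X" using x0(1) by (auto simp: X_simps x_def)
        ultimately show "\<exists>x\<in>carrier X. \<Phi> x = f" by (metis ext)
      qed
      then have "f \<in> \<Phi> ` carrier X" for f by (metis imageI)
      then have "\<Phi> ` carrier X = UNIV" by (rule UNIV_eq_I[symmetric])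
      moreover have "inj_on \<Phi> (carrier X)"
      proof (rule inj_onI)
        fix x y assume x: "x \<in> carrier X" and y: "y \<in> carrier X" and eq: "\<Phi> x = \<Phi> y"
        have "x i = y i" if i: "i \<in> I" for i
        proof (rule \<kappa>_inj[OF i])
          show "x i \<in> carrier (E i)" "y i \<in> carrier (E i)" using x y i by (auto simp: X_simps)
          show "\<forall>b\<in>B i. \<kappa> i b (x i) = \<kappa> i b (y i)" using eq \<Phi>_h[OF i] by metis
        qed
        then show "x = y" using x y by (auto simp: X_simps intro: extensionalityI[of _ I])
      qed
      ultimately show ?thesis by (simp add: bij_betw_def)
    qed
    show "\<Phi> (x \<oplus>\<^bsub>X\<^esub> y) = (\<lambda>j. \<Phi> x j + \<Phi> y j)"
      if "x \<in> carrier X" "y \<in> carrier X" for x y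
      using that g_mem by (auto simp: X_simps \<Phi>_def fun_eq_iff intro!: \<kappa>_add)
    show "\<Phi> (emb s \<odot>\<^bsub>X\<^esub> x) = (\<lambda>j. s * \<Phi> x j)" if "x \<in> carrier X" for s x
      using that g_mem by (auto simp: X_simps \<Phi>_def fun_eq_iff intro!: \<kappa>_scale)
    \<comment> \<open>The first \<open>N\<close> coordinates belong to the factors named by the
      first \<open>N\<close> pairs of the enumeration.\<close>
    show "\<exists>F. finite F \<and> F \<subseteq> I \<and> (\<forall>x\<in>carrier X.
        (\<forall>i\<in>F. x i = \<zero>\<^bsub>E i\<^esub>) \<longrightarrow> (\<forall>j<N. \<Phi> x j = 0))" for N
      by (rule exI[of _ "(\<lambda>j. fst (g j)) ` {..<N}"]) (use g_mem in \<open>auto simp: \<Phi>_def \<kappa>_zero\<close>)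
    show "\<exists>N. \<forall>x\<in>carrier X. (\<forall>j<N. \<Phi> x j = 0) \<longrightarrow> (\<forall>i\<in>F. x i = \<zero>\<^bsub>E i\<^esub>)"
      if F: "finite F" "F \<subseteq> I" for F
    proof -
      \<comment> \<open>Conversely, the factors in \<open>F\<close> occupy finitely many positions,
        and \<open>N\<close> is chosen beyond all of them.\<close>
      have "finite (\<Union>i\<in>F. h i ` B i)" using F finB by blast
      then obtain N where N: "\<forall>j\<in>(\<Union>i\<in>F. h i ` B i). j < N"
        using finite_nat_set_iff_bounded by blast
      have "x i = \<zero>\<^bsub>E i\<^esub>" if x: "x \<in> carrier X" "\<forall>j<N. \<Phi> x j = 0" and i: "i \<in> F" for x i
      proof (rule \<kappa>_inj)
        show "i \<in> I" using F i by blast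
        then show "x i \<in> carrier (E i)" "\<zero>\<^bsub>E i\<^esub> \<in> carrier (E i)"
          using x zero by (auto simp: X_simps)
        show "\<forall>b\<in>B i. \<kappa> i b (x i) = \<kappa> i b \<zero>\<^bsub>E i\<^esub>"
        proof
          fix b assume b: "b \<in> B i"
          have "\<kappa> i b (x i) = \<Phi> x (h i b)" using \<Phi>_h[OF \<open>i \<in> I\<close> b] by simp
          also have "\<dots> = 0" using x N i b by auto
          finally show "\<kappa> i b (x i) = \<kappa> i b \<zero>\<^bsub>E i\<^esub>" using \<kappa>_zero[OF \<open>i \<in> I\<close> b] by simp
        qed
      qed
      then show ?thesis by blast
    qed
  qed
qed

section \<open>Orbits near 0\<close>

context finite_dimensional_product
begin

lemma linear_operator_funpow:
  assumes "linear_operator K X T"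
  shows "linear_operator K X (T ^^ n)"
proof (induction n)
  case 0
  show ?case by (simp add: linear_operator_def)
next
  case (Suc n)
  then show ?case
    using assms by (simp add: linear_operator_def Pi_iff)
qed

text \<open>Continuity is taken from the inverse map that the homeomorphism provides; on the carrier
  it agrees with \<open>inv_into\<close>, the inverse used in \<open>int_iterate\<close>.\<close>

lemma invertible_operator_inverse:
  assumes "T \<in> invertible_operators K X \<tau>"
  defines "U \<equiv> inv_into (carrier X) T"
  shows "linear_operator K X U" "continuous_map \<tau> \<tau> U"
    "\<And>x. x \<in> carrier X \<Longrightarrow> U (T x) = x" "\<And>x. x \<in> carrier X \<Longrightarrow> T (U x) = x"
proof -
  have lin: "linear_operator K X T" and hom: "homeomorphic_map \<tau> \<tau> T"
    using assms by (auto simp: invertible_operators_def)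
  obtain g where g: "homeomorphic_maps \<tau> \<tau> T g"
    using hom by (auto simp: homeomorphic_map_maps)
  have bij: "bij_betw T (carrier X) (carrier X)"
    using homeomorphic_imp_injective_map[OF hom] homeomorphic_imp_surjective_map[OF hom]
    unfolding topspace_\<tau> bij_betw_def by blast
  show UT: "U (T x) = x" if "x \<in> carrier X" for x
    unfolding U_def using bij that by (rule bij_betw_inv_into_left)
  show TU: "T (U x) = x" if "x \<in> carrier X" for x
    unfolding U_def using bij that by (rule bij_betw_inv_into_right)
  have U_mem: "U x \<in> carrier X" if "x \<in> carrier X" for x
    unfolding U_def using that bij by (metis bij_betw_imp_surj_on inv_into_into)
  have gU: "g x = U x" if "x \<in> topspace \<tau>" for x
  proof -
    have x: "x \<in> carrier X" using that unfolding topspace_\<tau> .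
    have "g (T (U x)) = U x"
      using g U_mem[OF x] unfolding homeomorphic_maps_def topspace_\<tau> by blast
    then show ?thesis by (simp add: TU[OF x])
  qed
  have "continuous_map \<tau> \<tau> g" using g unfolding homeomorphic_maps_def by blast
  then show "continuous_map \<tau> \<tau> U" by (rule continuous_map_eq) (rule gU)
  show "linear_operator K X U"
    unfolding linear_operator_def
  proof (intro conjI ballI)
    show "U \<in> carrier X \<rightarrow> carrier X" using U_mem by blast
    fix x y assume x: "x \<in> carrier X" and y: "y \<in> carrier X"
    have "T (U x \<oplus>\<^bsub>X\<^esub> U y) = x \<oplus>\<^bsub>X\<^esub> y"
      using lin U_mem[OF x] U_mem[OF y] TU[OF x] TU[OF y] by (simp add: linear_operator_def)
    then show "U (x \<oplus>\<^bsub>X\<^esub> y) = U x \<oplus>\<^bsub>X\<^esub> U y"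
      using UT[of "U x \<oplus>\<^bsub>X\<^esub> U y"] U_mem x y by simp
  next
    fix a x assume a: "a \<in> K" and x: "x \<in> carrier X"
    have "T (a \<odot>\<^bsub>X\<^esub> U x) = a \<odot>\<^bsub>X\<^esub> x"
      using lin U_mem[OF x] TU[OF x] a by (simp add: linear_operator_def)
    then show "U (a \<odot>\<^bsub>X\<^esub> x) = a \<odot>\<^bsub>X\<^esub> U x"
      using UT[of "a \<odot>\<^bsub>X\<^esub> U x"] U_mem x a by simp
  qed
qed

end

section \<open>Transfer of operators to the sequence space\<close>

context coordinatized_product
begin

definition \<Psi> :: "(nat \<Rightarrow> 'k) \<Rightarrow> 'i \<Rightarrow> 'e"
  where "\<Psi> = inv_into (carrier X) \<Phi>"

lemma \<Psi>_mem [simp, intro]: "\<Psi> z \<in> carrier X"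
  using bij_\<Phi> by (metis \<Psi>_def UNIV_I bij_betw_def inv_into_into)

lemma \<Phi>_\<Psi> [simp]: "\<Phi> (\<Psi> z) = z"
  unfolding \<Psi>_def using bij_\<Phi> by (rule bij_betw_inv_into_right) simp

lemma \<Psi>_\<Phi> [simp]: "x \<in> carrier X \<Longrightarrow> \<Psi> (\<Phi> x) = x"
  unfolding \<Psi>_def using bij_\<Phi> by (rule bij_betw_inv_into_left)

lemma \<Psi>_add: "\<Psi> (\<lambda>j. x j + y j) = \<Psi> x \<oplus>\<^bsub>X\<^esub> \<Psi> y"
  using \<Psi>_\<Phi>[of "\<Psi> x \<oplus>\<^bsub>X\<^esub> \<Psi> y"] by (simp add: \<Phi>_add)

lemma \<Psi>_scale: "\<Psi> (\<lambda>j. s * x j) = emb s \<odot>\<^bsub>X\<^esub> \<Psi> x"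
  using \<Psi>_\<Phi>[of "emb s \<odot>\<^bsub>X\<^esub> \<Psi> x"] emb_mem[of s] by (simp add: \<Phi>_scale)

lemma \<Phi>_zero: "\<Phi> \<zero>\<^bsub>X\<^esub> = (\<lambda>_. 0)"
  using \<Phi>_scale[of "\<zero>\<^bsub>X\<^esub>" 0] X.smult_r_null[of "emb 0"] emb_mem[of 0] by simp

definition conjugate :: "(('i \<Rightarrow> 'e) \<Rightarrow> 'i \<Rightarrow> 'e) \<Rightarrow> (nat \<Rightarrow> 'k) \<Rightarrow> nat \<Rightarrow> 'k"
  where "conjugate T z = \<Phi> (T (\<Psi> z))"

lemma conjugate_funpow:
  assumes "linear_operator K X T"
  shows "(conjugate T ^^ n) z = conjugate (T ^^ n) z"
proof (induction n)
  case (Suc n)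
  have "(T ^^ n) (\<Psi> z) \<in> carrier X"
    using linear_operator_funpow[OF assms, of n] \<Psi>_mem[of z] unfolding linear_operator_def by blast
  then show ?case using Suc by (simp add: conjugate_def)
qed (simp add: conjugate_def)

text \<open>Three finite dependencies are chained: coordinate \<open>m\<close> on the components in
  \<open>F\<close>, these components of \<open>T x\<close> on the components of \<open>x\<close> in
  the sets \<open>G i\<close>, and those on the first \<open>N\<close> coordinates.\<close>

lemma row_finite_op_conjugate:
  assumes lin: "linear_operator K X T" and cont: "continuous_map \<tau> \<tau> T"
  shows "row_finite_op (conjugate T)"
  unfolding row_finite_op_def
proof (intro conjI allI)
  have T_mem: "T (\<Psi> z) \<in> carrier X" for z
    using lin \<Psi>_mem[of z] unfolding linear_operator_def by blast
  show "conjugate T (\<lambda>j. x j + y j) = (\<lambda>j. conjugate T x j + conjugate T y j)" for x y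
  proof -
    have "T (\<Psi> x \<oplus>\<^bsub>X\<^esub> \<Psi> y) = T (\<Psi> x) \<oplus>\<^bsub>X\<^esub> T (\<Psi> y)"
      using lin unfolding linear_operator_def by simp
    then show ?thesis by (simp add: conjugate_def \<Psi>_add \<Phi>_add T_mem)
  qed
  show "conjugate T (\<lambda>j. c * x j) = (\<lambda>j. c * conjugate T x j)" for c x
  proof -
    have "T (emb c \<odot>\<^bsub>X\<^esub> \<Psi> x) = emb c \<odot>\<^bsub>X\<^esub> T (\<Psi> x)"
      using lin emb_mem[of c] unfolding linear_operator_def by simp
    then show ?thesis by (simp add: conjugate_def \<Psi>_scale \<Phi>_scale T_mem)
  qed
  fix m
  obtain F where F: "finite F" "F \<subseteq> I"
    "\<forall>x\<in>carrier X. (\<forall>i\<in>F. x i = \<zero>\<^bsub>E i\<^esub>) \<longrightarrow> (\<forall>j<Suc m. \<Phi> x j = 0)"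
    using \<Phi>_finitely_determined[of "Suc m"] by blast
  have "\<exists>G. finite G \<and> G \<subseteq> I \<and>
      (\<forall>x\<in>carrier X. (\<forall>l\<in>G. x l = \<zero>\<^bsub>E l\<^esub>) \<longrightarrow> T x i = \<zero>\<^bsub>E i\<^esub>)" if "i \<in> F" for i
  proof -
    have "i \<in> I" using that F by blast
    from continuous_operator_finitely_determined[OF lin cont this] show ?thesis by metis
  qed
  then obtain G where G: "\<And>i. i \<in> F \<Longrightarrow> finite (G i)" "\<And>i. i \<in> F \<Longrightarrow> G i \<subseteq> I"
    "\<And>i x. \<lbrakk>i \<in> F; x \<in> carrier X; \<forall>l\<in>G i. x l = \<zero>\<^bsub>E l\<^esub>\<rbrakk> \<Longrightarrow> T x i = \<zero>\<^bsub>E i\<^esub>"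
    by metis
  have "finite (\<Union>i\<in>F. G i)" by (rule finite_UN_I[OF F(1)]) (rule G(1))
  moreover have "(\<Union>i\<in>F. G i) \<subseteq> I" by (rule UN_least) (rule G(2))
  ultimately have "\<exists>N. \<forall>x\<in>carrier X. (\<forall>j<N. \<Phi> x j = 0) \<longrightarrow> (\<forall>i\<in>(\<Union>i\<in>F. G i). x i = \<zero>\<^bsub>E i\<^esub>)"
    by (rule \<Phi>_finitely_determines)
  then obtain N where N:
    "\<forall>x\<in>carrier X. (\<forall>j<N. \<Phi> x j = 0) \<longrightarrow> (\<forall>i\<in>(\<Union>i\<in>F. G i). x i = \<zero>\<^bsub>E i\<^esub>)"
    by (rule exE)
  have "conjugate T z m = 0" if "\<forall>j<N. z j = 0" for z
  proof -
    have "\<forall>i\<in>(\<Union>i\<in>F. G i). \<Psi> z i = \<zero>\<^bsub>E i\<^esub>"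
      using N that by simp
    then have "\<forall>i\<in>F. T (\<Psi> z) i = \<zero>\<^bsub>E i\<^esub>" using G(3) by simp
    then show ?thesis using F(3) T_mem by (simp add: conjugate_def)
  qed
  then show "\<exists>N. \<forall>z. (\<forall>j<N. z j = 0) \<longrightarrow> conjugate T z m = 0" by blast
qed

text \<open>The number \<open>N\<close> depends only on the metric and \<delta>, so it can be fixed
  before the vector \<open>z\<close> is found. A family of operators in place of the powers of one
  map serves one-sided and two-sided orbits alike.\<close>

lemma small_vector_of_bounded_orbit:
  assumes d: "compatible_metric \<tau> d" and \<delta>: "\<delta> > 0"
  obtains N where "\<And>z \<A>. \<lbrakk>z \<noteq> (\<lambda>_. 0); \<And>A. A \<in> \<A> \<Longrightarrow> linear_operator K X A;
      finite {y \<in> (\<lambda>A. conjugate A z) ` \<A>. \<exists>j<N. y j \<noteq> 0}\<rbrakk> \<Longrightarrow>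
    \<exists>w\<in>carrier X. w \<noteq> \<zero>\<^bsub>X\<^esub> \<and> (\<forall>A\<in>\<A>. d (A w) (A \<zero>\<^bsub>X\<^esub>) < \<delta>)"
proof -
  obtain F where F: "finite F" "F \<subseteq> I"
    "\<And>S. S \<subseteq> carrier X \<Longrightarrow> finite {y \<in> S. \<exists>i\<in>F. y i \<noteq> \<zero>\<^bsub>E i\<^esub>} \<Longrightarrow>
      \<exists>c\<in>K - {0}. \<forall>y\<in>S. d (c \<odot>\<^bsub>X\<^esub> y) \<zero>\<^bsub>X\<^esub> < \<delta>"
    using bounded_set_shrinks_into_ball[OF d \<delta>] by blast
  obtain N where N: "\<forall>x\<in>carrier X. (\<forall>j<N. \<Phi> x j = 0) \<longrightarrow> (\<forall>i\<in>F. x i = \<zero>\<^bsub>E i\<^esub>)"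
    using \<Phi>_finitely_determines[OF F(1,2)] by blast
  show ?thesis
  proof (rule that)
    fix z :: "nat \<Rightarrow> 'k" and \<A>
    assume z: "z \<noteq> (\<lambda>_. 0)" and lin: "\<And>A. A \<in> \<A> \<Longrightarrow> linear_operator K X A"
      and fin: "finite {y \<in> (\<lambda>A. conjugate A z) ` \<A>. \<exists>j<N. y j \<noteq> 0}"
    define S where "S = (\<lambda>A. A (\<Psi> z)) ` \<A>"
    have "A (\<Psi> z) \<in> carrier X" if "A \<in> \<A>" for A
      using lin[OF that] \<Psi>_mem[of z] unfolding linear_operator_def by blast
    then have S: "S \<subseteq> carrier X" by (auto simp: S_def)
    \<comment> \<open>Where the first \<open>N\<close> coordinates vanish, the components in
      \<open>F\<close> do too. As \<Phi> is injective, finiteness passes from sequences back to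
      vectors.\<close>
    have "\<Phi> ` {y \<in> S. \<exists>i\<in>F. y i \<noteq> \<zero>\<^bsub>E i\<^esub>} \<subseteq> {y \<in> (\<lambda>A. conjugate A z) ` \<A>. \<exists>j<N. y j \<noteq> 0}"
      using N S by (auto simp: S_def conjugate_def)
    then have "finite (\<Phi> ` {y \<in> S. \<exists>i\<in>F. y i \<noteq> \<zero>\<^bsub>E i\<^esub>})"
      using fin by (rule finite_subset)
    moreover have "inj_on \<Phi> {y \<in> S. \<exists>i\<in>F. y i \<noteq> \<zero>\<^bsub>E i\<^esub>}"
      using bij_\<Phi> S by (auto simp: bij_betw_def intro: inj_on_subset)
    ultimately have "finite {y \<in> S. \<exists>i\<in>F. y i \<noteq> \<zero>\<^bsub>E i\<^esub>}"
      by (rule finite_imageD)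
    from F(3)[OF S this] obtain c where c: "c \<in> K" "c \<noteq> 0"
      and small: "\<forall>y\<in>S. d (c \<odot>\<^bsub>X\<^esub> y) \<zero>\<^bsub>X\<^esub> < \<delta>" by blast
    obtain s where s: "c = emb s" using c range_emb by blast
    define w where "w = c \<odot>\<^bsub>X\<^esub> \<Psi> z"
    have "w \<in> carrier X" using c by (simp add: w_def)
    moreover have "w \<noteq> \<zero>\<^bsub>X\<^esub>"
    proof
      assume "w = \<zero>\<^bsub>X\<^esub>"
      then have "(\<lambda>j. s * z j) = (\<lambda>_. 0)"
        using \<Phi>_scale[OF \<Psi>_mem, of s z] by (simp add: w_def s \<Phi>_zero)
      moreover have "s \<noteq> 0" using c s by auto
      ultimately show False using z by (auto simp: fun_eq_iff)
    qed
    moreover have "d (A w) (A \<zero>\<^bsub>X\<^esub>) < \<delta>" if A: "A \<in> \<A>" for A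
    proof -
      have "A w = c \<odot>\<^bsub>X\<^esub> A (\<Psi> z)"
        using lin[OF A] c unfolding linear_operator_def w_def by simp
      then show ?thesis
        using small A by (auto simp: S_def linear_operator_zero[OF lin[OF A]])
    qed
    ultimately show "\<exists>w\<in>carrier X. w \<noteq> \<zero>\<^bsub>X\<^esub> \<and> (\<forall>A\<in>\<A>. d (A w) (A \<zero>\<^bsub>X\<^esub>) < \<delta>)"
      by blast
  qed
qed

section \<open>Failure of expansiveness\<close>

text \<open>The pair of points that stays closer than \<delta> consists of 0 and a small nonzero
  multiple of a vector with bounded orbit.\<close>

lemma not_metrically_positively_expansive:
  assumes d: "compatible_metric \<tau> d" and T: "T \<in> continuous_operators K X \<tau>"
  shows "\<not> metrically_positively_expansive (carrier X) d T"
proof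
  assume "metrically_positively_expansive (carrier X) d T"
  then obtain \<delta> where \<delta>: "\<delta> > 0"
    "\<forall>x\<in>carrier X. \<forall>y\<in>carrier X. x \<noteq> y \<longrightarrow> (\<exists>n. d ((T ^^ n) x) ((T ^^ n) y) \<ge> \<delta>)"
    unfolding metrically_positively_expansive_def by blast
  have lin: "linear_operator K X T" and cont: "continuous_map \<tau> \<tau> T"
    using T by (auto simp: continuous_operators_def)
  obtain N where N: "\<And>z \<A>. \<lbrakk>z \<noteq> (\<lambda>_. 0); \<And>A. A \<in> \<A> \<Longrightarrow> linear_operator K X A;
      finite {y \<in> (\<lambda>A. conjugate A z) ` \<A>. \<exists>j<N. y j \<noteq> 0}\<rbrakk> \<Longrightarrow>
    \<exists>w\<in>carrier X. w \<noteq> \<zero>\<^bsub>X\<^esub> \<and> (\<forall>A\<in>\<A>. d (A w) (A \<zero>\<^bsub>X\<^esub>) < \<delta>)"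
    using small_vector_of_bounded_orbit[OF d \<delta>(1)] by blast
  obtain z where z: "z \<noteq> (\<lambda>_. 0)" "finite {y \<in> range (\<lambda>n. (conjugate T ^^ n) z). \<exists>j<N. y j \<noteq> 0}"
    using exists_bounded_orbit[OF row_finite_op_conjugate[OF lin cont]] by blast
  define \<A> where "\<A> = range (\<lambda>n. T ^^ n)"
  have "(\<lambda>A. conjugate A z) ` \<A> = range (\<lambda>n. (conjugate T ^^ n) z)"
    by (auto simp: \<A>_def conjugate_funpow[OF lin])
  with z have "\<exists>w\<in>carrier X. w \<noteq> \<zero>\<^bsub>X\<^esub> \<and> (\<forall>A\<in>\<A>. d (A w) (A \<zero>\<^bsub>X\<^esub>) < \<delta>)"
    by (intro N) (auto simp: \<A>_def linear_operator_funpow[OF lin])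
  then obtain w where w: "w \<in> carrier X" "w \<noteq> \<zero>\<^bsub>X\<^esub>" "\<And>n. d ((T ^^ n) w) ((T ^^ n) \<zero>\<^bsub>X\<^esub>) < \<delta>"
    by (auto simp: \<A>_def)
  then obtain n where "d ((T ^^ n) w) ((T ^^ n) \<zero>\<^bsub>X\<^esub>) \<ge> \<delta>"
    using \<delta>(2) X.zero_closed by blast
  with w(3)[of n] show False by simp
qed

lemma not_metrically_expansive:
  assumes d: "compatible_metric \<tau> d" and T: "T \<in> invertible_operators K X \<tau>"
  shows "\<not> metrically_expansive (carrier X) d T"
proof
  assume "metrically_expansive (carrier X) d T"
  then obtain \<delta> where \<delta>: "\<delta> > 0"
    "\<forall>x\<in>carrier X. \<forall>y\<in>carrier X. x \<noteq> y \<longrightarrow>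
      (\<exists>n. d (int_iterate (carrier X) T n x) (int_iterate (carrier X) T n y) \<ge> \<delta>)"
    unfolding metrically_expansive_def by blast
  have lin: "linear_operator K X T" and cont: "continuous_map \<tau> \<tau> T"
    using T by (auto simp: invertible_operators_def homeomorphic_imp_continuous_map)
  define U where "U = inv_into (carrier X) T"
  note U = invertible_operator_inverse[OF T, folded U_def]
  obtain N where N: "\<And>z \<A>. \<lbrakk>z \<noteq> (\<lambda>_. 0); \<And>A. A \<in> \<A> \<Longrightarrow> linear_operator K X A;
      finite {y \<in> (\<lambda>A. conjugate A z) ` \<A>. \<exists>j<N. y j \<noteq> 0}\<rbrakk> \<Longrightarrow>
    \<exists>w\<in>carrier X. w \<noteq> \<zero>\<^bsub>X\<^esub> \<and> (\<forall>A\<in>\<A>. d (A w) (A \<zero>\<^bsub>X\<^esub>) < \<delta>)"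
    using small_vector_of_bounded_orbit[OF d \<delta>(1)] by blast
  have mem: "T x \<in> carrier X" "U x \<in> carrier X" if "x \<in> carrier X" for x
    using lin U(1) that unfolding linear_operator_def by blast+
  have "conjugate U (conjugate T z) = z" "conjugate T (conjugate U z) = z" for z
    by (simp_all add: conjugate_def mem U)
  then obtain z where z: "z \<noteq> (\<lambda>_. 0)"
    "finite {y \<in> range (\<lambda>n. (conjugate T ^^ n) z) \<union> range (\<lambda>n. (conjugate U ^^ n) z). \<exists>j<N. y j \<noteq> 0}"
    using exists_bounded_two_sided_orbit[OF row_finite_op_conjugate[OF lin cont]
        row_finite_op_conjugate[OF U(1,2)]] by blast
  define \<A> where "\<A> = range (\<lambda>n. T ^^ n) \<union> range (\<lambda>n. U ^^ n)"
  have "(\<lambda>A. conjugate A z) ` \<A> = range (\<lambda>n. (conjugate T ^^ n) z) \<union> range (\<lambda>n. (conjugate U ^^ n) z)"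
    by (auto simp: \<A>_def conjugate_funpow[OF lin] conjugate_funpow[OF U(1)])
  with z have "\<exists>w\<in>carrier X. w \<noteq> \<zero>\<^bsub>X\<^esub> \<and> (\<forall>A\<in>\<A>. d (A w) (A \<zero>\<^bsub>X\<^esub>) < \<delta>)"
    by (intro N) (auto simp: \<A>_def linear_operator_funpow[OF lin] linear_operator_funpow[OF U(1)])
  then obtain w where w: "w \<in> carrier X" "w \<noteq> \<zero>\<^bsub>X\<^esub>"
    and small: "\<forall>A\<in>\<A>. d (A w) (A \<zero>\<^bsub>X\<^esub>) < \<delta>" by blast
  have "int_iterate (carrier X) T n \<in> \<A>" for n
    by (auto simp: \<A>_def int_iterate_def U_def)
  moreover obtain n where "d (int_iterate (carrier X) T n w) (int_iterate (carrier X) T n \<zero>\<^bsub>X\<^esub>) \<ge> \<delta>"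
    using \<delta>(2) w X.zero_closed by blast
  ultimately show False using small by (metis not_le)
qed

end

lemma (in finite_dimensional_product) not_expansive:
  assumes d: "compatible_metric \<tau> d"
  shows "\<forall>T\<in>continuous_operators K X \<tau>. \<not> metrically_positively_expansive (carrier X) d T"
    "\<forall>T\<in>invertible_operators K X \<tau>. \<not> metrically_expansive (carrier X) d T"
proof -
  obtain \<Phi> where "coordinatized_product K emb I E nrm \<Phi>"
    by (rule exists_coordinates)
  then interpret coordinatized_product K emb I E nrm \<Phi> .
  show "\<forall>T\<in>continuous_operators K X \<tau>. \<not> metrically_positively_expansive (carrier X) d T"
    "\<forall>T\<in>invertible_operators K X \<tau>. \<not> metrically_expansive (carrier X) d T"
    using not_metrically_positively_expansive[OF d] not_metrically_expansive[OF d] by blast+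
qed

lemma field_embedding_of_real: "field_embedding \<real> complex_of_real"
  by unfold_locales (auto simp: Reals_def inj_def)

lemma field_embedding_id: "field_embedding UNIV (\<lambda>z::complex. z)"
  by unfold_locales auto

theorem theorem3:
  fixes K :: "complex set" and I :: "'i set"
    and E :: "'i \<Rightarrow> (complex, 'e) module" and nrm :: "'i \<Rightarrow> 'e \<Rightarrow> real"
    and X :: "(complex, 'i \<Rightarrow> 'e) module" and \<tau> :: "('i \<Rightarrow> 'e) topology"
    and d :: "('i \<Rightarrow> 'e) \<Rightarrow> ('i \<Rightarrow> 'e) \<Rightarrow> real"
  assumes "K = \<real> \<or> K = UNIV"
    and "countable I" and "infinite I"
    and "\<And>i. i \<in> I \<Longrightarrow> normed_space_over K (E i) (nrm i)"
    and "\<And>i. i \<in> I \<Longrightarrow> finite_dimensional K (E i)"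
    and "\<And>i. i \<in> I \<Longrightarrow> carrier (E i) \<noteq> {\<zero>\<^bsub>E i\<^esub>}"
    and "X = product_module I E"
    and "\<tau> = product_topology (\<lambda>i. norm_topology (E i) (nrm i)) I"
    and "compatible_metric \<tau> d"
  shows "(\<forall>T \<in> continuous_operators K X \<tau>. \<not> metrically_positively_expansive (carrier X) d T) \<and>
         (\<forall>T \<in> invertible_operators K X \<tau>. \<not> metrically_expansive (carrier X) d T)"
proof -
  have ax: "finite_dimensional_product_axioms K I E nrm"
    using assms(1-6) by (simp add: finite_dimensional_product_axioms_def)
  show ?thesis
  \<comment> \<open>As a type, the field of scalars is \<open>real\<close> in the first case and
    \<open>complex\<close> in the second.\<close>
  proof (cases "K = \<real>")
    case True
    interpret finite_dimensional_product K complex_of_real I E nrm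
      using field_embedding_of_real ax True by (simp add: finite_dimensional_product_def)
    show ?thesis
      using not_expansive assms(7-9) by blast
  next
    case False
    then have "K = UNIV" using assms(1) by blast
    then interpret finite_dimensional_product K "\<lambda>z. z" I E nrm
      using field_embedding_id ax by (simp add: finite_dimensional_product_def)
    show ?thesis
      using not_expansive assms(7-9) by blast
  qed
qed

end
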